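(* Let $k \ge 3$ be an integer and let $\beta^k$ be the $k$-dimensional cross polytope. The $2$-skeleton $\operatorname{skel}_2(\beta^k)$ can be decomposed into triangulated vertex transitive closed surfaces. More precisely: (a) if $k \equiv 1$ or $2 \pmod 3$, then $\operatorname{skel}_2(\beta^k)$ decomposes into $\frac{(k-1)(k-2)}{3}$ triangulated vertex transitive closed surfaces of Euler characteristic $0$, each on $2k$ vertices; (b) if $k \equiv 0 \pmod 3$, then $\operatorname{skel}_2(\beta^k)$ decomposes into $\frac{k}{3}$ disjoint copies of $\partial\beta^3$ (on $6$ vertices each) and $\frac{k(k-3)}{3}$ triangulated vertex transitive closed surfaces of Euler characteristic $0$, each on $2k$ vertices.
   Context: The $k$-dimensional cross polytope $\beta^k$ is the convex hull of the $2k$ points $(0,\ldots,0,\pm 1,0,\ldots,0)\in\mathbb{R}^k$. Combinatorially, label its vertices by $0,\ldots,2k-1$ so that the diagonals (pairs of antipodal vertices) are $\{i,k+i\}$, $0\le i\le k-1$; its boundary complex is $$\partial\beta^k=\{\langle a_1,\ldots,a_k\rangle \mid a_i\in\{0,\ldots,2k-1\},\ \{i,k+i\}\not\subseteq\{a_1,\ldots,a_k\}\ \text{for all } 0\le i\le k-1\}$$ (listing the facets, i.e. the $k$-element vertex sets containing no diagonal). The $2$-skeleton $\operatorname{skel}_2(\beta^k)$ is the set of all faces of dimension at most $2$; its triangles are the $3$-element subsets of $\{0,\ldots,2k-1\}$ containing no diagonal. In particular $\partial\beta^3$ is the boundary of the octahedron. A triangulated closed surface is a finite $2$-dimensional simplicial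 complex in which the link of every vertex is a cycle (the boundary of a polygon); it is not required to be connected. It is vertex transitive if its group of simplicial automorphisms acts transitively on its vertices. "$\operatorname{skel}_2(\beta^k)$ decomposes into" a family of surfaces means that each surface of the family is a subcomplex of $\operatorname{skel}_2(\beta^k)$ and that every triangle of $\beta^k$ belongs to exactly one surface of the family. *)

theory Defs
  imports Complex_Main
begin

text \<open>
  A finite abstract simplicial complex is the set of its nonempty faces; the empty face is never
  listed, so that the face sums below need no correction term.
\<close>

definition simplicial_complex :: "'a set set \<Rightarrow> bool" where
  "simplicial_complex K \<longleftrightarrow>
     finite K \<and>
     (\<forall>s\<in>K. finite s \<and> s \<noteq> {}) \<and>
     (\<forall>s\<in>K. \<forall>t. t \<noteq> {} \<and> t \<subseteq> s \<longrightarrow> t \<in> K)"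

definition vertices :: "'a set set \<Rightarrow> 'a set" where
  "vertices K = \<Union> K"

definition face_dim :: "'a set \<Rightarrow> nat" where
  "face_dim s = card s - 1"

definition skeleton :: "nat \<Rightarrow> 'a set set \<Rightarrow> 'a set set" where
  "skeleton d K = {s \<in> K. face_dim s \<le> d}"

definition euler_char :: "'a set set \<Rightarrow> int" where
  "euler_char K = (\<Sum>s\<in>K. (- 1) ^ face_dim s)"

definition link :: "'a set set \<Rightarrow> 'a \<Rightarrow> 'a set set" where
  "link K v = {s. s \<noteq> {} \<and> v \<notin> s \<and> insert v s \<in> K}"

definition is_cycle :: "'a set set \<Rightarrow> bool" where
  "is_cycle L \<longleftrightarrow>
     (\<exists>n\<ge>3. \<exists>c :: nat \<Rightarrow> 'a. inj_on c {..<n} \<and>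
        L = {{c i} | i. i < n} \<union> {{c i, c ((i + 1) mod n)} | i. i < n})"

definition closed_surface :: "'a set set \<Rightarrow> bool" where
  "closed_surface K \<longleftrightarrow>
     simplicial_complex K \<and>
     (\<forall>s\<in>K. face_dim s \<le> 2) \<and> (\<exists>s\<in>K. face_dim s = 2) \<and>
     (\<forall>v\<in>vertices K. is_cycle (link K v))"

definition simplicial_iso :: "('a \<Rightarrow> 'b) \<Rightarrow> 'a set set \<Rightarrow> 'b set set \<Rightarrow> bool" where
  "simplicial_iso f K L \<longleftrightarrow>
     bij_betw f (vertices K) (vertices L) \<and> (\<lambda>s. f ` s) ` K = L"

definition isomorphic_complexes :: "'a set set \<Rightarrow> 'b set set \<Rightarrow> bool" where
  "isomorphic_complexes K L \<longleftrightarrow> (\<exists>f. simplicial_iso f K L)"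

definition vertex_transitive :: "'a set set \<Rightarrow> bool" where
  "vertex_transitive K \<longleftrightarrow>
     (\<forall>u\<in>vertices K. \<forall>v\<in>vertices K. \<exists>f. simplicial_iso f K K \<and> f u = v)"

definition cross_facets :: "nat \<Rightarrow> nat set set" where
  "cross_facets k =
     {s. s \<subseteq> {0..<2 * k} \<and> card s = k \<and> (\<forall>i<k. \<not> {i, k + i} \<subseteq> s)}"

definition cross_boundary :: "nat \<Rightarrow> nat set set" where
  "cross_boundary k = {s. s \<noteq> {} \<and> (\<exists>t\<in>cross_facets k. s \<subseteq> t)}"

text \<open>
  For \<open>k \<ge> 3\<close> the only face of the polytope outside its boundary complex is the polytope
  itself, of dimension \<open>k > 2\<close>, so the 2-skeleton of the polytope is that of the boundary.
\<close>

definition cross_skel2 :: "nat \<Rightarrow> nat set set" where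
  "cross_skel2 k = skeleton 2 (cross_boundary k)"

text \<open>
  A family may be taken as a set: two equal members would share a triangle, which the
  uniqueness requirement forbids.
\<close>

definition decomposes_into :: "'a set set \<Rightarrow> 'a set set set \<Rightarrow> bool" where
  "decomposes_into K \<F> \<longleftrightarrow>
     finite \<F> \<and>
     (\<forall>S\<in>\<F>. closed_surface S \<and> S \<subseteq> K) \<and>
     (\<forall>t\<in>K. face_dim t = 2 \<longrightarrow> (\<exists>!S. S \<in> \<F> \<and> t \<in> S))"

end

theory Submission
  imports Defs "HOL-Number_Theory.Cong"
begin

text \<open>
  Identify the vertices with the residues modulo \<open>2k\<close>, so that the diagonals are the pairs with
  difference \<open>k\<close>. A complex invariant under all translations is determined by the link of \<open>0\<close>, that
  is, by the pairs \<open>(p, q)\<close> for which \<open>{0, p, q}\<close> is a triangle. For a generic triangle \<open>{0, p, q}\<close> these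
  pairs are the edges of the hexagon \<open>p, q, q - p, - p, - q, p - q\<close>. The hexagon degenerates exactly when
  the triangle is isosceles, of the form \<open>{0, a, 2a}\<close> up to translation; since \<open>2a = 2(a + k)\<close>, the
  triangles \<open>{0, a, 2a}\<close> and \<open>{0, a + k, 2a}\<close> share an edge of type \<open>2a\<close>, and together their translates have
  the hexagonal link \<open>a, 2a, a + k, - a - k, - 2a, - a\<close>. This fails only if \<open>k\<close> divides \<open>3a\<close>; then
  \<open>k = 3m\<close>, and the remaining triangles form the octahedra on the residue classes modulo \<open>m\<close>.
  Hexagonal links at all vertices give Euler characteristic \<open>0\<close>, and each hexagon accounts for 12 of
  the \<open>(2k - 2)(2k - 4)\<close> admissible pairs \<open>(p, q)\<close> (the octahedra account for 8), which gives the number of surfaces.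
\<close>

section \<open>Translation-invariant complexes on residues\<close>

text \<open>\<open>R\<close> sees only the differences from one corner, as unreduced integers; the
  relations used are invariant modulo \<open>n\<close>. Taking all nonempty subsets of the triangles
  makes the family closed under faces at once.\<close>

definition circ_faces :: "nat \<Rightarrow> nat \<Rightarrow> nat \<Rightarrow> (int \<Rightarrow> int \<Rightarrow> bool) \<Rightarrow> nat set set" where
  "circ_faces n m j R =
     {s. s \<noteq> {} \<and> (\<exists>x y z. x < n \<and> y < n \<and> z < n \<and> x mod m = j \<and> y mod m = j \<and> z mod m = j \<and>
        R (int y - int x) (int z - int x) \<and> s \<subseteq> {x, y, z})}"

lemma nat_cong_unique:
  fixes x y n :: nat
  assumes "[int x = int y] (mod int n)" "x < n" "y < n"
  shows "x = y"
  using assms by (simp add: cong_int_iff cong_less_modulus_unique_nat)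

text \<open>
  The link of a vertex \<open>v\<close> is the cycle through the residues \<open>v + h\<close>, for \<open>h\<close> in the list \<open>hs\<close>. Restricting
  the vertices to a residue class modulo \<open>m\<close> separates the octahedra from each other.
\<close>

locale circulant =
  fixes n m j :: nat and R :: "int \<Rightarrow> int \<Rightarrow> bool" and hs :: "int list"
  assumes n_pos: "n > 0" and m_dvd: "m dvd n" and j_less: "j < m"
    and len: "length hs \<ge> 3"
    and m_dvd_h: "\<And>h. h \<in> set hs \<Longrightarrow> int m dvd h"
    and h_nz: "\<And>h. h \<in> set hs \<Longrightarrow> \<not> int n dvd h"
    and dist: "distinct (map (\<lambda>h. h mod int n) hs)"
    and R_iff: "\<And>p q. R p q \<longleftrightarrow> (\<exists>i<length hs.
        [p = hs ! i] (mod int n) \<and> [q = hs ! (Suc i mod length hs)] (mod int n) \<or>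
        [q = hs ! i] (mod int n) \<and> [p = hs ! (Suc i mod length hs)] (mod int n))"
    and R_base: "\<And>p q. R p q \<Longrightarrow> R (- p) (q - p)"
begin

abbreviation "d \<equiv> length hs"
abbreviation "K \<equiv> circ_faces n m j R"

section \<open>Vertices and their neighbours along the cycle\<close>

definition vset :: "nat set" where "vset = {x. x < n \<and> x mod m = j}"

definition nbr :: "nat \<Rightarrow> nat \<Rightarrow> nat" where "nbr v i = nat ((int v + hs ! i) mod int n)"

abbreviation nx :: "nat \<Rightarrow> nat" where "nx i \<equiv> Suc i mod d"

lemma d_pos: "d > 0" using len by linarith

lemma nx_less: "nx i < d" using d_pos by simp

lemma nx_neq: "i < d \<Longrightarrow> nx i \<noteq> i"
  using len by (auto simp: mod_Suc)

text \<open>On a cycle with at least three vertices, two steps never lead back to the start, so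
  distinct steps give distinct unordered edges.\<close>

lemma nx_nx_neq: "i < d \<Longrightarrow> nx (nx i) \<noteq> i"
  using len by (auto simp: mod_Suc split: if_splits)

lemma R_sym: "R p q \<Longrightarrow> R q p"
  unfolding R_iff by blast

lemma R_cong: "[p = p'] (mod int n) \<Longrightarrow> [q = q'] (mod int n) \<Longrightarrow> R p q \<Longrightarrow> R p' q'"
  unfolding R_iff by (meson cong_sym cong_trans)

lemma nbr_less: "nbr v i < n"
  using n_pos by (simp add: nbr_def nat_less_iff)

lemma nbr_cong: "[int (nbr v i) = int v + hs ! i] (mod int n)"
  using n_pos by (simp add: nbr_def cong_def)

lemma eq_nbr_iff: "y < n \<Longrightarrow> y = nbr v i \<longleftrightarrow> [int y - int v = hs ! i] (mod int n)"
proof -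
  assume y: "y < n"
  have "[int y - int v = hs ! i] (mod int n) \<longleftrightarrow> [int y = int v + hs ! i] (mod int n)"
    by (metis add.commute cong_add_rcancel diff_add_cancel)
  also have "\<dots> \<longleftrightarrow> [int y = int (nbr v i)] (mod int n)"
    using nbr_cong cong_sym cong_trans by blast
  also have "\<dots> \<longleftrightarrow> y = nbr v i"
    using nat_cong_unique[OF _ y nbr_less] by auto
  finally show ?thesis by simp
qed

lemma nbr_inj: "i < d \<Longrightarrow> i' < d \<Longrightarrow> nbr v i = nbr v i' \<Longrightarrow> i = i'"
proof -
  assume a: "i < d" "i' < d" "nbr v i = nbr v i'"
  then have "[int v + hs ! i = int v + hs ! i'] (mod int n)"
    using nbr_cong cong_sym cong_trans by metis
  then have "hs ! i mod int n = hs ! i' mod int n"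
    by (metis cong_add_lcancel cong_def)
  then show "i = i'"
    using dist a by (simp add: distinct_conv_nth) metis
qed

lemma nbr_neq: "i < d \<Longrightarrow> v < n \<Longrightarrow> nbr v i \<noteq> v"
proof
  assume a: "i < d" "v < n" "nbr v i = v"
  then have "[int v + hs ! i = int v] (mod int n)"
    using nbr_cong cong_sym by metis
  then have "int n dvd hs ! i" by (simp add: cong_iff_dvd_diff)
  with h_nz a(1) show False by simp
qed

lemma vset_shift:
  assumes "v \<in> vset" "int m dvd e" shows "nat ((int v + e) mod int n) \<in> vset"
proof -
  have "int (nat ((int v + e) mod int n) mod m) = (int v + e) mod int n mod int m"
    using n_pos by (simp add: zmod_int)
  also have "\<dots> = (int v + e) mod int m" using m_dvd by (simp add: mod_mod_cancel)
  also have "\<dots> = int v mod int m" using assms(2) by (metis add.commute mod_add_self1 dvdE mod_mult_self2)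
  also have "\<dots> = int j" using assms(1) by (auto simp: vset_def simp flip: zmod_int)
  finally show ?thesis using n_pos by (simp add: vset_def nat_less_iff)
qed

lemma nbr_vset: "v \<in> vset \<Longrightarrow> i < d \<Longrightarrow> nbr v i \<in> vset"
  unfolding nbr_def by (rule vset_shift) (simp_all add: m_dvd_h)

section \<open>Faces and triangles through a given vertex\<close>

lemma R_link:
  assumes "y < n" "z < n"
  shows "R (int y - int v) (int z - int v) \<longleftrightarrow>
    (\<exists>i<d. y = nbr v i \<and> z = nbr v (nx i) \<or> z = nbr v i \<and> y = nbr v (nx i))"
  using assms by (simp add: R_iff eq_nbr_iff)

lemma faces_alt: "K = {s. s \<noteq> {} \<and> (\<exists>x\<in>vset. \<exists>y\<in>vset. \<exists>z\<in>vset.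
    R (int y - int x) (int z - int x) \<and> s \<subseteq> {x, y, z})}"
  unfolding circ_faces_def vset_def by blast

text \<open>Every corner of a triangle may serve as its base: \<open>R_base\<close> together with
  \<open>R_sym\<close> moves the base from \<open>x\<close> to \<open>y\<close> or \<open>z\<close>.
  So all faces through \<open>v\<close> are read off the cycle around \<open>v\<close>.\<close>

lemma face_at_iff:
  assumes "v \<in> s"
  shows "s \<in> K \<longleftrightarrow> v \<in> vset \<and> (\<exists>i<d. s \<subseteq> {v, nbr v i, nbr v (nx i)})"
proof
  assume "s \<in> K"
  then obtain x y z where vset: "x \<in> vset" "y \<in> vset" "z \<in> vset"
    and R: "R (int y - int x) (int z - int x)" and s: "s \<subseteq> {x, y, z}"
    unfolding faces_alt by blast
  have Ry: "R (int x - int y) (int z - int y)"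
    using R_base[OF R] by simp
  have Rz: "R (int x - int z) (int y - int z)"
    using R_base[OF R_sym[OF R]] by simp
  have "\<exists>y' z'. y' \<in> vset \<and> z' \<in> vset \<and> R (int y' - int v) (int z' - int v) \<and> s \<subseteq> {v, y', z'} \<and> v \<in> vset"
  proof -
    consider "v = x" | "v = y" | "v = z" using s assms by auto
    then show ?thesis
    proof cases
      case 1 then show ?thesis using vset R s by blast
    next
      case 2 then show ?thesis using vset Ry s by blast
    next
      case 3 then show ?thesis using vset Rz s by blast
    qed
  qed
  then obtain y' z' where *: "y' < n" "z' < n" "R (int y' - int v) (int z' - int v)" "s \<subseteq> {v, y', z'}" "v \<in> vset"
    unfolding vset_def by blast
  then show "v \<in> vset \<and> (\<exists>i<d. s \<subseteq> {v, nbr v i, nbr v (nx i)})"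
    unfolding R_link[OF *(1,2)] by blast
next
  assume "v \<in> vset \<and> (\<exists>i<d. s \<subseteq> {v, nbr v i, nbr v (nx i)})"
  then obtain i where i: "v \<in> vset" "i < d" "s \<subseteq> {v, nbr v i, nbr v (nx i)}" by blast
  have "R (int (nbr v i) - int v) (int (nbr v (nx i)) - int v)"
    using R_link[OF nbr_less nbr_less] i(2) by blast
  then show "s \<in> K"
    unfolding faces_alt using i nbr_vset nx_less assms by blast
qed

text \<open>With three distinct corners, the two corners other than \<open>x\<close> must be
  consecutive on the cycle around \<open>x\<close>, so one pair of differences decides
  membership.\<close>

lemma triangle_in_iff:
  assumes "x < n" "y < n" "z < n" "x \<noteq> y" "x \<noteq> z" "y \<noteq> z"
  shows "{x, y, z} \<in> K \<longleftrightarrow> x \<in> vset \<and> R (int y - int x) (int z - int x)"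
proof -
  have "{x, y, z} \<subseteq> {x, nbr x i, nbr x (nx i)} \<longleftrightarrow>
      y = nbr x i \<and> z = nbr x (nx i) \<or> z = nbr x i \<and> y = nbr x (nx i)" for i
    using assms by auto
  then show ?thesis
    using face_at_iff[of x "{x, y, z}"] R_link[OF assms(2,3)] by simp
qed

section \<open>Links, the surface property and vertex transitivity\<close>

lemma face_card: "s \<in> K \<Longrightarrow> finite s \<and> s \<noteq> {} \<and> card s \<le> 3 \<and> s \<subseteq> vset"
proof -
  assume "s \<in> K"
  then obtain x y z where *: "s \<noteq> {}" "s \<subseteq> {x, y, z}" "{x, y, z} \<subseteq> vset" unfolding faces_alt by blast
  have "card s \<le> card {x, y, z}" using *(2) by (intro card_mono) auto
  also have "\<dots> \<le> 3" by (simp add: card_insert_if)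
  finally show ?thesis using * finite_subset by auto
qed

lemma finite_vset: "finite vset" by (simp add: vset_def)

lemma finite_K: "finite K"
  using finite_subset[of K "Pow vset"] finite_vset face_card by auto

lemma triangle_at: "v \<in> vset \<Longrightarrow> i < d \<Longrightarrow> {v, nbr v i, nbr v (nx i)} \<in> K"
  using face_at_iff by blast

lemma card_triangle_at: "v \<in> vset \<Longrightarrow> i < d \<Longrightarrow> card {v, nbr v i, nbr v (nx i)} = 3"
proof -
  assume a: "v \<in> vset" "i < d"
  have "v < n" using a by (simp add: vset_def)
  then have "nbr v i \<noteq> v" "nbr v (nx i) \<noteq> v" "nbr v i \<noteq> nbr v (nx i)"
    using a nbr_neq nx_less nx_neq nbr_inj by metis+
  then show ?thesis by auto
qed

lemma vertices_K: "vertices K = vset"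
  unfolding vertices_def using face_card triangle_at d_pos by blast

lemma simplicial: "simplicial_complex K"
proof -
  have "t \<in> K" if st: "s \<in> K" "t \<noteq> {}" "t \<subseteq> s" for s t
  proof -
    obtain v where "v \<in> t" using st(2) by blast
    then show ?thesis
      using face_at_iff[of v s] face_at_iff[of v t] st(1,3) by (meson subset_iff subset_trans)
  qed
  then show ?thesis unfolding simplicial_complex_def using finite_K face_card by blast
qed

text \<open>The map \<open>nbr v\<close> is injective on indices and misses \<open>v\<close>, so
  removing \<open>v\<close> from the faces through it leaves exactly the points and edges of a
  cycle.\<close>

lemma link_cycle: "v \<in> vset \<Longrightarrow> is_cycle (link K v)"
proof -
  assume v: "v \<in> vset"
  then have vn: "v < n" by (simp add: vset_def)
  have nc: "v \<noteq> nbr v i" if "i < d" for i using nbr_neq[OF that vn] by simp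
  have inj: "inj_on (nbr v) {..<d}" using nbr_inj by (auto simp: inj_on_def)
  have "s \<in> link K v \<longleftrightarrow> s \<in> {{nbr v i} | i. i < d} \<union> {{nbr v i, nbr v ((i + 1) mod d)} | i. i < d}" for s
  proof
    assume "s \<in> link K v"
    then have s: "s \<noteq> {}" "v \<notin> s" "insert v s \<in> K" by (auto simp: link_def)
    then obtain i where i: "i < d" "insert v s \<subseteq> {v, nbr v i, nbr v (nx i)}"
      using face_at_iff[of v "insert v s"] by auto
    then have "s \<subseteq> {nbr v i, nbr v (nx i)}" using s(2) by auto
    then have "s = {nbr v i} \<or> s = {nbr v (nx i)} \<or> s = {nbr v i, nbr v (nx i)}" using s(1) by auto
    then show "s \<in> {{nbr v i} | i. i < d} \<union> {{nbr v i, nbr v ((i + 1) mod d)} | i. i < d}"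
      using i(1) nx_less by auto
  next
    assume "s \<in> {{nbr v i} | i. i < d} \<union> {{nbr v i, nbr v ((i + 1) mod d)} | i. i < d}"
    then obtain i where i: "i < d" "s = {nbr v i} \<or> s = {nbr v i, nbr v (nx i)}" by auto
    then have "insert v s \<subseteq> {v, nbr v i, nbr v (nx i)}" "s \<noteq> {}" "v \<notin> s"
      using nc nx_less by auto
    then show "s \<in> link K v"
      using face_at_iff[of v "insert v s"] v i(1) by (auto simp: link_def)
  qed
  then have "link K v = {{nbr v i} | i. i < d} \<union> {{nbr v i, nbr v ((i + 1) mod d)} | i. i < d}"
    by (rule set_eqI)
  then show ?thesis unfolding is_cycle_def using len inj by blast
qed

lemma vset_nonempty: "j \<in> vset"
  using j_less m_dvd n_pos by (auto simp: vset_def dest: dvd_imp_le)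

lemma closed: "closed_surface K"
  unfolding closed_surface_def
proof (intro conjI ballI)
  show "simplicial_complex K" by (rule simplicial)
  show "face_dim s \<le> 2" if "s \<in> K" for s
    using face_card[OF that] unfolding face_dim_def by linarith
  show "\<exists>s\<in>K. face_dim s = 2"
    using triangle_at[OF vset_nonempty d_pos] card_triangle_at[OF vset_nonempty d_pos]
    by (intro bexI[of _ "{j, nbr j 0, nbr j (nx 0)}"]) (simp_all add: face_dim_def)
  show "is_cycle (link K v)" if "v \<in> vertices K" for v
    using that vertices_K link_cycle by simp
qed

text \<open>The translation by \<open>v - u\<close> modulo \<open>n\<close> is the automorphism; it
  keeps the residue class because \<open>m\<close> divides \<open>v - u\<close>.\<close>

lemma transitive: "vertex_transitive K"
  unfolding vertex_transitive_def vertices_K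
proof (intro ballI)
  fix u v assume u: "u \<in> vset" and v: "v \<in> vset"
  define sh where "sh e x = nat ((int x + e) mod int n)" for e and x :: nat
  define e where "e = int v - int u"
  have me: "int m dvd e" "int m dvd - e"
  proof -
    have "int v mod int m = int u mod int m"
      using u v by (simp add: vset_def flip: zmod_int)
    then show "int m dvd e" by (simp add: e_def mod_eq_dvd_iff)
    then show "int m dvd - e" by simp
  qed
  have shW: "sh e' x \<in> vset" if "x \<in> vset" "int m dvd e'" for e' x
    using vset_shift that by (simp add: sh_def)
  have sh_cong: "[int (sh e' x) = int x + e'] (mod int n)" for e' x
    using n_pos by (simp add: sh_def cong_def)
  \<comment> \<open>Translating back undoes a translation; this yields bijectivity on the vertices
    and, further below, surjectivity on the faces.\<close>
  have inv: "sh (- e') (sh e' x) = x" if "x \<in> vset" for e' x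
  proof -
    have "[int (sh (- e') (sh e' x)) = int (sh e' x) - e'] (mod int n)"
      using sh_cong[of "- e'"] by simp
    moreover have "[int (sh e' x) - e' = int x + e' - e'] (mod int n)"
      using sh_cong by (intro cong_diff) auto
    ultimately have "[int (sh (- e') (sh e' x)) = int x] (mod int n)"
      using cong_trans by fastforce
    then show ?thesis using n_pos that
      by (intro nat_cong_unique) (auto simp: sh_def nat_less_iff vset_def)
  qed
  have bij: "bij_betw (sh e) vset vset"
    using inv[of _ e] inv[of _ "- e"] me shW by (intro bij_betw_byWitness[where f' = "sh (- e)"]) auto
  have img: "sh e' ` s \<in> K" if s: "s \<in> K" and e': "int m dvd e'" for s e'
  proof -
    obtain x y z where vset: "x \<in> vset" "y \<in> vset" "z \<in> vset"
      and R: "R (int y - int x) (int z - int x)" and s: "s \<noteq> {}" "s \<subseteq> {x, y, z}"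
      using s unfolding faces_alt by blast
    have "[int a - int b = int (sh e' a) - int (sh e' b)] (mod int n)" for a b
      using cong_diff[OF sh_cong[of e' a] sh_cong[of e' b]] by (simp add: cong_sym)
    then have "R (int (sh e' y) - int (sh e' x)) (int (sh e' z) - int (sh e' x))"
      using R R_cong by blast
    moreover have "sh e' ` s \<subseteq> {sh e' x, sh e' y, sh e' z}" using s(2) by blast
    ultimately show ?thesis unfolding faces_alt using shW[OF _ e'] vset s(1) by blast
  qed
  have "(\<lambda>s. sh e ` s) ` K = K"
  proof
    show "(\<lambda>s. sh e ` s) ` K \<subseteq> K" using img me by blast
    show "K \<subseteq> (\<lambda>s. sh e ` s) ` K"
    proof
      fix s assume s: "s \<in> K"
      have "sh e (sh (- e) x) = x" if "x \<in> s" for x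
        using inv[of x "- e"] that face_card[OF s] by auto
      then have "sh e ` sh (- e) ` s = s" by (simp add: image_image)
      then show "s \<in> (\<lambda>s. sh e ` s) ` K" using img[OF s me(2)] by (metis image_eqI)
    qed
  qed
  then have "simplicial_iso (sh e) K K"
    using bij by (simp add: simplicial_iso_def vertices_K)
  moreover have "sh e u = v" using v by (simp add: sh_def e_def vset_def)
  ultimately show "\<exists>f. simplicial_iso f K K \<and> f u = v" by blast
qed

section \<open>Face numbers and the Euler characteristic\<close>

text \<open>Edges through \<open>v\<close> correspond to the points of its link.\<close>

lemma edges_at:
  assumes v: "v \<in> vset" shows "card {s \<in> K. card s = 2 \<and> v \<in> s} = d"
proof -
  have vn: "v < n" using v by (simp add: vset_def)
  have "{s \<in> K. card s = 2 \<and> v \<in> s} = (\<lambda>i. {v, nbr v i}) ` {..<d}" (is "?L = ?R")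
  proof
    show "?L \<subseteq> ?R"
    proof
      fix s assume s: "s \<in> ?L"
      then obtain i where i: "i < d" "s \<subseteq> {v, nbr v i, nbr v (nx i)}" using face_at_iff by blast
      obtain w where "s = {v, w}" "w \<noteq> v" using s by (auto simp: card_2_iff)
      then have "s = {v, nbr v i} \<or> s = {v, nbr v (nx i)}" using i by auto
      then show "s \<in> ?R" using i nx_less by blast
    qed
    show "?R \<subseteq> ?L"
    proof
      fix s assume "s \<in> ?R"
      then obtain i where i: "i < d" "s = {v, nbr v i}" by blast
      then have "s \<in> K" using face_at_iff[of v s] v by blast
      moreover have "card s = 2" using i nbr_neq[OF i(1) vn] by (auto simp: card_insert_if)
      ultimately show "s \<in> ?L" using i by simp
    qed
  qed
  moreover have "inj_on (\<lambda>i. {v, nbr v i}) {..<d}"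
    using nbr_inj nbr_neq[OF _ vn] by (auto simp: inj_on_def doubleton_eq_iff)
  ultimately show ?thesis by (simp add: card_image)
qed

text \<open>Triangles through \<open>v\<close> correspond to the edges of its link.\<close>

lemma triangles_at:
  assumes v: "v \<in> vset" shows "card {s \<in> K. card s = 3 \<and> v \<in> s} = d"
proof -
  have vn: "v < n" using v by (simp add: vset_def)
  have "{s \<in> K. card s = 3 \<and> v \<in> s} = (\<lambda>i. {v, nbr v i, nbr v (nx i)}) ` {..<d}" (is "?L = ?R")
  proof
    show "?L \<subseteq> ?R"
    proof
      fix s assume s: "s \<in> ?L"
      then obtain i where i: "i < d" "s \<subseteq> {v, nbr v i, nbr v (nx i)}" using face_at_iff by blast
      then have "s = {v, nbr v i, nbr v (nx i)}"
        using s card_triangle_at[OF v i(1)] by (intro card_subset_eq) auto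
      then show "s \<in> ?R" using i by blast
    qed
    show "?R \<subseteq> ?L" using triangle_at card_triangle_at v by auto
  qed
  moreover have "inj_on (\<lambda>i. {v, nbr v i, nbr v (nx i)}) {..<d}"
  proof (rule inj_onI)
    fix i i' assume i: "i \<in> {..<d}" "i' \<in> {..<d}" "{v, nbr v i, nbr v (nx i)} = {v, nbr v i', nbr v (nx i')}"
    have "v \<notin> {nbr v i, nbr v (nx i)}" "v \<notin> {nbr v i', nbr v (nx i')}"
      using nbr_neq[OF _ vn] i nx_less by (metis empty_iff insert_iff lessThan_iff)+
    then have "{nbr v i, nbr v (nx i)} = {nbr v i', nbr v (nx i')}" using i(3) by (metis insert_ident)
    \<comment> \<open>Two edges of the cycle with the same ends either coincide or are traversed in
      opposite directions; the latter would close the cycle after two steps.\<close>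
    then have "i = i' \<or> i = nx i' \<and> nx i = i'"
      unfolding doubleton_eq_iff using nbr_inj i nx_less by blast
    then show "i = i'" using nx_nx_neq i by auto
  qed
  ultimately show ?thesis by (simp add: card_image)
qed

text \<open>Double counting of the pairs of a vertex and an \<open>r\<close>-element face containing
  it.\<close>

lemma incidence: 
  assumes "\<And>v. v \<in> vset \<Longrightarrow> card {s \<in> K. card s = r \<and> v \<in> s} = t"
  shows "r * card {s \<in> K. card s = r} = t * card vset"
proof -
  have "sum (\<lambda>s. card {v \<in> vset. v \<in> s}) {s \<in> K. card s = r} = t * card vset"
    using assms finite_K finite_vset by (intro sum_multicount) (auto simp: conj_ac)
  moreover have "card {v \<in> vset. v \<in> s} = r" if "s \<in> {s \<in> K. card s = r}" for s
  proof -
    have "{v \<in> vset. v \<in> s} = s" using face_card that by auto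
    then show ?thesis using that by simp
  qed
  ultimately show ?thesis by (simp add: mult.commute)
qed

text \<open>Every vertex lies on six edges and six triangles, so V vertices come with 3V edges and
  2V triangles, and V - 3V + 2V = 0.\<close>

lemma euler_zero: "d = 6 \<Longrightarrow> euler_char K = 0"
proof -
  assume d: "d = 6"
  have "{s \<in> K. card s = 1} = (\<lambda>v. {v}) ` vset"
    using triangle_at d_pos face_card face_at_iff by (fastforce simp: card_1_singleton_iff)
  then have n1: "card {s \<in> K. card s = 1} = card vset" by (simp add: card_image)
  have n2: "2 * card {s \<in> K. card s = 2} = 6 * card vset" using incidence edges_at d by simp
  have n3: "3 * card {s \<in> K. card s = 3} = 6 * card vset" using incidence triangles_at d by simp
  have K: "K = {s \<in> K. card s = 1} \<union> {s \<in> K. card s = 2} \<union> {s \<in> K. card s = 3}"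
  proof -
    have "card s \<in> {1, 2, 3}" if "s \<in> K" for s
    proof -
      have "card s > 0" "card s \<le> 3" using face_card[OF that] by (auto simp: card_gt_0_iff)
      then show ?thesis by auto
    qed
    then show ?thesis by blast
  qed
  have "euler_char K = (\<Sum>s\<in>{s \<in> K. card s = 1}. (- 1) ^ face_dim s) + (\<Sum>s\<in>{s \<in> K. card s = 2}. (- 1) ^ face_dim s)
      + (\<Sum>s\<in>{s \<in> K. card s = 3}. (- 1) ^ face_dim s)"
    unfolding euler_char_def using finite_K
    by (subst K, subst sum.union_disjoint, simp, simp, force, subst sum.union_disjoint) auto
  also have "\<dots> = int (card {s \<in> K. card s = 1}) - int (card {s \<in> K. card s = 2}) + int (card {s \<in> K. card s = 3})"
    by (simp add: face_dim_def)
  finally show ?thesis using n1 n2 n3 by linarith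
qed

text \<open>Each edge of the cycle gives two ordered pairs; \<open>nx_nx_neq\<close> prevents an
  edge from being the reverse of another.\<close>

lemma card_pairs: "card {(p, q). p < n \<and> q < n \<and> R (int p) (int q)} = 2 * d"
proof -
  define f where "f i = (nbr 0 i, nbr 0 (nx i))" for i
  define g where "g i = (nbr 0 (nx i), nbr 0 i)" for i
  have "{(p, q). p < n \<and> q < n \<and> R (int p) (int q)} = f ` {..<d} \<union> g ` {..<d}"
    (is "?L = _")
  proof (rule set_eqI, clarify)
    fix p q
    have "(p, q) \<in> ?L \<longleftrightarrow> p < n \<and> q < n \<and> (\<exists>i<d. p = nbr 0 i \<and> q = nbr 0 (nx i) \<or> q = nbr 0 i \<and> p = nbr 0 (nx i))"
      using R_link[of p q 0] by auto
    also have "\<dots> \<longleftrightarrow> (\<exists>i<d. p = nbr 0 i \<and> q = nbr 0 (nx i) \<or> q = nbr 0 i \<and> p = nbr 0 (nx i))"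
      using nbr_less by blast
    also have "\<dots> \<longleftrightarrow> (p, q) \<in> f ` {..<d} \<union> g ` {..<d}"
      unfolding f_def g_def by blast
    finally show "(p, q) \<in> ?L \<longleftrightarrow> (p, q) \<in> f ` {..<d} \<union> g ` {..<d}" .
  qed
  moreover have "f ` {..<d} \<inter> g ` {..<d} = {}"
  proof -
    have "f i \<noteq> g i'" if "i < d" "i' < d" for i i'
    proof
      assume "f i = g i'"
      then have "i = nx i'" "nx i = i'" using nbr_inj that nx_less by (auto simp: f_def g_def)
      then show False using nx_nx_neq that by blast
    qed
    then show ?thesis by blast
  qed
  moreover have "inj_on f {..<d}" "inj_on g {..<d}"
    using nbr_inj by (auto simp: inj_on_def f_def g_def)
  ultimately show ?thesis by (simp add: card_Un_disjoint card_image)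
qed

end

section \<open>Hexagons\<close>

text \<open>The right-hand side repeats the locale assumption \<open>R_iff\<close>, which therefore
  holds by definition.\<close>

definition cyc_adj :: "nat \<Rightarrow> int list \<Rightarrow> int \<Rightarrow> int \<Rightarrow> bool" where
  "cyc_adj n hs p q \<longleftrightarrow> (\<exists>i<length hs.
     [p = hs ! i] (mod int n) \<and> [q = hs ! (Suc i mod length hs)] (mod int n) \<or>
     [q = hs ! i] (mod int n) \<and> [p = hs ! (Suc i mod length hs)] (mod int n))"

text \<open>Consecutive entries are the images of \<open>(p, q)\<close> under repeated rotation to
  \<open>(q, q - p)\<close>: the six neighbours of the origin in the triangular lattice generated by
  \<open>p\<close> and \<open>q\<close>.\<close>

definition hexagon :: "int \<Rightarrow> int \<Rightarrow> int list" where
  "hexagon p q = [p, q, q - p, - p, - q, p - q]"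

text \<open>The triangle on \<open>0\<close>, \<open>a\<close>, \<open>2 * a\<close> accounts for
  the edges from \<open>a\<close> to \<open>2 * a\<close>, from \<open>- a\<close> to
  \<open>a\<close> and from \<open>- 2 * a\<close> to \<open>- a\<close>; the same triangle for
  \<open>a + int k\<close> supplies the other three.\<close>

definition iso_hexagon :: "nat \<Rightarrow> int \<Rightarrow> int list" where
  "iso_hexagon k a = [a, 2 * a, a + int k, - a - int k, - 2 * a, - a]"

text \<open>Modulo \<open>2 * k\<close> the multiples of \<open>k\<close> are \<open>0\<close> and
  its antipode, so the corners \<open>0\<close>, \<open>p\<close>, \<open>q\<close> are distinct and
  contain no diagonal.\<close>

definition valid :: "nat \<Rightarrow> int \<Rightarrow> int \<Rightarrow> bool" where
  "valid k p q \<longleftrightarrow> \<not> int k dvd p \<and> \<not> int k dvd q \<and> \<not> int k dvd q - p"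

text \<open>The three alternatives place the apex at \<open>0\<close>, at \<open>p\<close> and at
  \<open>q\<close>.\<close>

definition isosceles :: "nat \<Rightarrow> int \<Rightarrow> int \<Rightarrow> bool" where
  "isosceles k p q \<longleftrightarrow> 2 * int k dvd p + q \<or> 2 * int k dvd q - 2 * p \<or> 2 * int k dvd p - 2 * q"

text \<open>The second factor fixes the leg up to sign; stating it modulo \<open>k\<close> covers
  \<open>a\<close> and \<open>a + int k\<close> together.\<close>

definition iso_adj :: "nat \<Rightarrow> int \<Rightarrow> int \<Rightarrow> int \<Rightarrow> bool" where
  "iso_adj k a p q \<longleftrightarrow>
     2 * int k dvd p + q \<and> (int k dvd p - a \<or> int k dvd p + a) \<or>
     2 * int k dvd q - 2 * p \<and> (int k dvd p - a \<or> int k dvd p + a) \<or>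
     2 * int k dvd p - 2 * q \<and> (int k dvd q - a \<or> int k dvd q + a)"

text \<open>For \<open>k = 3 * m\<close> the divisibility conditions make \<open>p\<close> and
  \<open>q\<close> multiples of \<open>m\<close>, so the triangle stays in one coset of the subgroup
  of order 6.\<close>

definition oct_adj :: "nat \<Rightarrow> int \<Rightarrow> int \<Rightarrow> bool" where
  "oct_adj k p q \<longleftrightarrow> valid k p q \<and> int k dvd 3 * p \<and> int k dvd 3 * q"

lemma ex_less_4: "(\<exists>i<4. P i) \<longleftrightarrow> P 0 \<or> P 1 \<or> P 2 \<or> P (3::nat)"
  by (simp add: numeral_eq_Suc less_Suc_eq ex_disj_distrib conj_disj_distribR disj_ac)

lemma ex_less_6: "(\<exists>i<6. P i) \<longleftrightarrow> P 0 \<or> P 1 \<or> P 2 \<or> P 3 \<or> P 4 \<or> P (5::nat)"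
  by (simp add: numeral_eq_Suc less_Suc_eq ex_disj_distrib conj_disj_distribR disj_ac)

definition pair_cong :: "nat \<Rightarrow> int \<Rightarrow> int \<Rightarrow> int \<Rightarrow> int \<Rightarrow> bool" where
  "pair_cong n p q u v \<longleftrightarrow> [p = u] (mod int n) \<and> [q = v] (mod int n) \<or> [q = u] (mod int n) \<and> [p = v] (mod int n)"

lemma pair_cong_swap: "pair_cong n p q u v \<longleftrightarrow> pair_cong n p q v u"
  by (auto simp: pair_cong_def)

lemma length_hexagon: "length (hexagon a b) = 6"
  by (simp add: hexagon_def)

lemma length_iso_hexagon: "length (iso_hexagon k a) = 6"
  by (simp add: iso_hexagon_def)

lemma cyc_adj_hexagon:
  "cyc_adj n (hexagon a b) p q \<longleftrightarrow>
     pair_cong n p q a b \<or> pair_cong n p q b (b - a) \<or> pair_cong n p q (b - a) (- a) \<or>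
     pair_cong n p q (- a) (- b) \<or> pair_cong n p q (- b) (a - b) \<or> pair_cong n p q (a - b) a"
  unfolding cyc_adj_def length_hexagon ex_less_6 by (simp add: hexagon_def pair_cong_def)

lemma cyc_adj_iso_hexagon:
  "cyc_adj n (iso_hexagon k a) p q \<longleftrightarrow>
     pair_cong n p q a (2 * a) \<or> pair_cong n p q (2 * a) (a + int k) \<or>
     pair_cong n p q (a + int k) (- a - int k) \<or> pair_cong n p q (- a - int k) (- 2 * a) \<or>
     pair_cong n p q (- 2 * a) (- a) \<or> pair_cong n p q (- a) a"
  unfolding cyc_adj_def length_iso_hexagon ex_less_6 by (simp add: iso_hexagon_def pair_cong_def)

section \<open>Generic hexagons as orbits of pairs\<close>

lemma hexagon_swap: "cyc_adj n (hexagon b a) = cyc_adj n (hexagon a b)"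
  unfolding fun_eq_iff cyc_adj_hexagon using pair_cong_swap by blast

text \<open>The list of the rotated pair is the same cycle shifted by one place.\<close>

lemma hexagon_rot: "cyc_adj n (hexagon b (b - a)) = cyc_adj n (hexagon a b)"
  unfolding fun_eq_iff cyc_adj_hexagon by (auto simp: algebra_simps)

lemma hexagon_cong_aux:
  assumes "[a = a'] (mod int n)" "[b = b'] (mod int n)" "cyc_adj n (hexagon a b) p q"
  shows "cyc_adj n (hexagon a' b') p q"
proof -
  have *: "pair_cong n p q u' v'" if "pair_cong n p q u v" "[u = u'] (mod int n)" "[v = v'] (mod int n)" for u v u' v'
    using that unfolding pair_cong_def by (meson cong_trans)
  have "[- a = - a'] (mod int n)" "[- b = - b'] (mod int n)" "[a - b = a' - b'] (mod int n)" "[b - a = b' - a'] (mod int n)"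
    using assms by (auto intro: cong_diff simp: cong_minus_minus_iff)
  then show ?thesis using assms * unfolding cyc_adj_hexagon by blast
qed

lemma hexagon_cong:
  assumes "[a = a'] (mod int n)" "[b = b'] (mod int n)"
  shows "cyc_adj n (hexagon a b) = cyc_adj n (hexagon a' b')"
  using hexagon_cong_aux assms cong_sym unfolding fun_eq_iff by blast

text \<open>
  Renaming the vertices of a triangle acts on its pair of differences by the group of order 12
  generated by \<open>(p, q) \<mapsto> (q, p)\<close> and the rotation \<open>(p, q) \<mapsto> (q, q - p)\<close> of order 6.
\<close>

lemma hexagon_orbit_induct:
  assumes adj: "cyc_adj n (hexagon a b) p q" and Q: "Q a b"
    and swap: "\<And>p q. Q p q \<Longrightarrow> Q q p" and rot: "\<And>p q. Q p q \<Longrightarrow> Q q (q - p)"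
    and cong: "\<And>p q p' q'. [p = p'] (mod int n) \<Longrightarrow> [q = q'] (mod int n) \<Longrightarrow> Q p q \<Longrightarrow> Q p' q'"
  shows "Q p q"
proof -
  have 1: "Q b (b - a)" using rot Q by blast
  then have 2: "Q (b - a) (- a)" using rot by fastforce
  then have 3: "Q (- a) (- b)" using rot by fastforce
  then have 4: "Q (- b) (a - b)" using rot by fastforce
  then have 5: "Q (a - b) a" using rot by fastforce
  have "Q p q" if "pair_cong n p q u v" "Q u v" for u v
    using that swap cong cong_sym unfolding pair_cong_def by meson
  then show ?thesis using adj Q 1 2 3 4 5 unfolding cyc_adj_hexagon by blast
qed

text \<open>The edges of a hexagon form a single orbit, so each of them generates the whole hexagon.
  This gives both the change of base point and uniqueness.\<close>

lemma cyc_adj_hexagon_eq: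
  assumes "cyc_adj n (hexagon a b) p q"
  shows "cyc_adj n (hexagon p q) = cyc_adj n (hexagon a b)"
  using assms by (rule hexagon_orbit_induct) (auto simp: hexagon_swap hexagon_rot dest: hexagon_cong)

section \<open>Validity and isosceles triangles along an orbit\<close>

lemma cong_dvd_double:
  assumes "[p = p'] (mod int (2 * k))"
  shows "[p = p'] (mod int k)"
  using assms by (rule cong_dvd_modulus) simp

lemma valid_swap: "valid k p q \<Longrightarrow> valid k q p"
  by (simp add: valid_def dvd_diff_commute)

lemma valid_rot: "valid k p q \<Longrightarrow> valid k q (q - p)"
  by (simp add: valid_def)

lemma valid_cong:
  assumes "[p = p'] (mod int (2 * k))" "[q = q'] (mod int (2 * k))" "valid k p q"
  shows "valid k p' q'"
  using assms cong_dvd_double[OF assms(1)] cong_dvd_double[OF assms(2)] unfolding valid_def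
  by (meson cong_diff cong_dvd_iff)

lemma isosceles_swap: "isosceles k p q \<Longrightarrow> isosceles k q p"
  by (auto simp: isosceles_def add.commute)

text \<open>The rotation permutes the three apex conditions cyclically, up to sign.\<close>

lemma isosceles_rot: "isosceles k q (q - p) \<longleftrightarrow> isosceles k p q"
proof -
  have "2 * int k dvd q + (q - p) \<longleftrightarrow> 2 * int k dvd p - 2 * q"
    by (subst dvd_minus_iff[symmetric]) (simp add: algebra_simps)
  moreover have "2 * int k dvd (q - p) - 2 * q \<longleftrightarrow> 2 * int k dvd p + q"
    by (subst dvd_minus_iff[symmetric]) (simp add: algebra_simps)
  moreover have "2 * int k dvd q - 2 * (q - p) \<longleftrightarrow> 2 * int k dvd q - 2 * p"
    by (subst dvd_minus_iff[symmetric]) (simp add: algebra_simps)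
  ultimately show ?thesis unfolding isosceles_def by blast
qed

lemma isosceles_cong:
  assumes "[p = p'] (mod int (2 * k))" "[q = q'] (mod int (2 * k))" "isosceles k p q"
  shows "isosceles k p' q'"
proof -
  have "[p + q = p' + q'] (mod int (2 * k))" "[q - 2 * p = q' - 2 * p'] (mod int (2 * k))"
       "[p - 2 * q = p' - 2 * q'] (mod int (2 * k))"
    using assms by (auto intro!: cong_diff cong_add cong_scalar_left)
  then show ?thesis using assms(3) unfolding isosceles_def
    by (metis cong_dvd_iff of_nat_mult of_nat_numeral)
qed

lemma hexagon_adj_valid:
  assumes "cyc_adj (2 * k) (hexagon a b) p q" "valid k a b"
  shows "valid k p q"
  using assms by (rule hexagon_orbit_induct) (auto intro: valid_swap valid_rot valid_cong)

lemma hexagon_adj_not_isosceles: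
  assumes "cyc_adj (2 * k) (hexagon a b) p q" "\<not> isosceles k a b"
  shows "\<not> isosceles k p q"
  using assms
proof (rule hexagon_orbit_induct)
  show "\<not> isosceles k p' q'"
    if "[p = p'] (mod int (2 * k))" "[q = q'] (mod int (2 * k))" "\<not> isosceles k p q" for p q p' q'
    using that isosceles_cong[OF cong_sym cong_sym] by blast
qed (auto simp: isosceles_rot dest: isosceles_swap)

lemma dvd_double: "2 * int k dvd 2 * x \<longleftrightarrow> int k dvd x"
  by simp

lemma not_dvd_2k: "\<not> int k dvd x \<Longrightarrow> \<not> 2 * int k dvd x"
  using dvd_mult_right by blast

text \<open>Serves the distinctness checks, where each difference of two list entries matches one of
  a few known non-multiples up to sign.\<close>

lemma not_dvd_upto_sign: "\<not> n dvd x \<Longrightarrow> y = x \<or> y = - x \<Longrightarrow> \<not> n dvd (y :: int)"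
  by auto

text \<open>Up to sign, the differences of entries are \<open>a\<close>, \<open>b\<close>,
  \<open>b - a\<close>, their doubles, and \<open>a + b\<close>, \<open>b - 2 * a\<close>,
  \<open>a - 2 * b\<close>. Validity excludes the first six as multiples of \<open>2 * k\<close>;
  excluding the last three is exactly what not being isosceles means.\<close>

lemma circulant_hexagon:
  assumes k: "k > 0" and v: "valid k a b" and i: "\<not> isosceles k a b"
  shows "circulant (2 * k) 1 0 (cyc_adj (2 * k) (hexagon a b)) (hexagon a b)"
proof
  let ?h = "hexagon a b" and ?n = "2 * int k"
  show "2 * k > 0" using k by simp
  show "3 \<le> length ?h" by (simp add: hexagon_def)
  have nd: "\<not> ?n dvd a" "\<not> ?n dvd b" "\<not> ?n dvd b - a"
    using v not_dvd_2k unfolding valid_def by auto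
  show "\<not> int (2 * k) dvd h" if "h \<in> set ?h" for h
    using that nd by (auto simp: hexagon_def dvd_diff_commute)
  have nd2: "\<not> ?n dvd 2 * a" "\<not> ?n dvd 2 * b" "\<not> ?n dvd 2 * (b - a)"
    using v unfolding dvd_double valid_def by auto
  have ni: "\<not> ?n dvd a + b" "\<not> ?n dvd b - 2 * a" "\<not> ?n dvd a - 2 * b"
    using i by (auto simp: isosceles_def)
  have "distinct (map (\<lambda>h. h mod ?n) ?h)"
    unfolding hexagon_def
    by (simp only: list.map distinct.simps list.set insert_iff empty_iff mod_eq_dvd_iff de_Morgan_disj
        not_False_eq_True simp_thms; intro conjI;
        ((rule not_dvd_upto_sign[OF nd(1)], (simp; fail)) |
        (rule not_dvd_upto_sign[OF nd(2)], (simp; fail)) |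
        (rule not_dvd_upto_sign[OF nd(3)], (simp; fail)) |
        (rule not_dvd_upto_sign[OF nd2(1)], (simp; fail)) |
        (rule not_dvd_upto_sign[OF nd2(2)], (simp; fail)) |
        (rule not_dvd_upto_sign[OF nd2(3)], (simp; fail)) |
        (rule not_dvd_upto_sign[OF ni(1)], (simp; fail)) |
        (rule not_dvd_upto_sign[OF ni(2)], (simp; fail)) |
        (rule not_dvd_upto_sign[OF ni(3)], (simp; fail))))
  then show "distinct (map (\<lambda>h. h mod int (2 * k)) ?h)" by simp
  show "cyc_adj (2 * k) ?h p q \<longleftrightarrow> (\<exists>i<length ?h.
     [p = ?h ! i] (mod int (2 * k)) \<and> [q = ?h ! (Suc i mod length ?h)] (mod int (2 * k)) \<or>
     [q = ?h ! i] (mod int (2 * k)) \<and> [p = ?h ! (Suc i mod length ?h)] (mod int (2 * k)))" for p q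
    by (rule cyc_adj_def)
  \<comment> \<open>The pair is the edge from \<open>q - p\<close> to \<open>- p\<close> of the
    hexagon of \<open>p\<close> and \<open>q\<close>, which has the same edges as
    \<open>?h\<close>.\<close>
  show "cyc_adj (2 * k) ?h (- p) (q - p)" if "cyc_adj (2 * k) ?h p q" for p q
    using cyc_adj_hexagon_eq[OF that] 
    by (metis cyc_adj_hexagon pair_cong_def cong_refl)
qed auto

section \<open>Links made of isosceles triangles\<close>

text \<open>Swapping exchanges the apexes \<open>p\<close> and \<open>q\<close>. With apex
  \<open>0\<close> the legs are opposite, so if one is \<open>a\<close> up to sign modulo
  \<open>k\<close>, so is the other.\<close>

lemma iso_adj_sym: "iso_adj k a p q \<Longrightarrow> iso_adj k a q p"
proof -
  assume "iso_adj k a p q"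
  moreover have "int k dvd q - a \<or> int k dvd q + a" if pq: "2 * int k dvd p + q" and "int k dvd p - a \<or> int k dvd p + a"
  proof -
    have "int k dvd p + q" using pq dvd_mult_right by blast
    moreover have "q - a = (p + q) - (p + a)" "q + a = (p + q) - (p - a)" by simp_all
    ultimately show ?thesis using that(2) by (metis dvd_diff)
  qed
  ultimately show ?thesis unfolding iso_adj_def by (auto simp: add.commute)
qed

lemma iso_adj_cong:
  assumes "[p = p'] (mod int (2 * k))" "[q = q'] (mod int (2 * k))" "iso_adj k a p q"
  shows "iso_adj k a p' q'"
proof -
  have "[p + q = p' + q'] (mod int (2 * k))" "[q - 2 * p = q' - 2 * p'] (mod int (2 * k))"
       "[p - 2 * q = p' - 2 * q'] (mod int (2 * k))"
    using assms by (auto intro!: cong_diff cong_add cong_scalar_left)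
  then have "2 * int k dvd p + q \<longleftrightarrow> 2 * int k dvd p' + q'" "2 * int k dvd q - 2 * p \<longleftrightarrow> 2 * int k dvd q' - 2 * p'"
    "2 * int k dvd p - 2 * q \<longleftrightarrow> 2 * int k dvd p' - 2 * q'"
    by (metis cong_dvd_iff of_nat_mult of_nat_numeral)+
  moreover have "int k dvd x + a \<longleftrightarrow> int k dvd x' + a" "int k dvd x - a \<longleftrightarrow> int k dvd x' - a"
    if "[x = x'] (mod int (2 * k))" for x x'
    using cong_dvd_double[OF that] by (auto intro!: cong_dvd_iff cong_diff cong_add)
  ultimately show ?thesis using assms unfolding iso_adj_def by metis
qed

text \<open>Moving the base point to \<open>p\<close> exchanges the first two apex conditions and
  keeps the third, where \<open>p\<close> is \<open>2 * q\<close> modulo \<open>k\<close> and the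
  new leg \<open>q - p\<close> is therefore \<open>- q\<close>.\<close>

lemma iso_adj_base: "iso_adj k a p q \<Longrightarrow> iso_adj k a (- p) (q - p)"
proof -
  have *: "int k dvd - p - a \<longleftrightarrow> int k dvd p + a" "int k dvd - p + a \<longleftrightarrow> int k dvd p - a"
    by (metis dvd_minus_iff minus_diff_eq minus_add_distrib uminus_add_conv_diff diff_minus_eq_add add.commute)+
  have e: "- p + (q - p) = q - 2 * p" "(q - p) - 2 * (- p) = p + q" by simp_all
  have m: "2 * int k dvd (- p) - 2 * (q - p)" if "2 * int k dvd p - 2 * q"
    using that by (simp add: algebra_simps)
  have q: "int k dvd q - p - a \<longleftrightarrow> int k dvd - q - a" "int k dvd q - p + a \<longleftrightarrow> int k dvd - q + a"
    if "2 * int k dvd p - 2 * q"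
  proof -
    have d: "int k dvd 2 * q - p" using that by (metis dvd_mult_right dvd_diff_commute)
    have "q - p - a = (2 * q - p) + (- q - a)" "q - p + a = (2 * q - p) + (- q + a)" by simp_all
    then show "int k dvd q - p - a \<longleftrightarrow> int k dvd - q - a" "int k dvd q - p + a \<longleftrightarrow> int k dvd - q + a"
      using d dvd_add_right_iff by metis+
  qed
  have *: "int k dvd - x - a \<longleftrightarrow> int k dvd x + a" "int k dvd - x + a \<longleftrightarrow> int k dvd x - a" for x
    by (metis dvd_minus_iff minus_diff_eq minus_add_distrib uminus_add_conv_diff diff_minus_eq_add add.commute)+
  assume "iso_adj k a p q"
  then show ?thesis unfolding iso_adj_def e using * q m by blast
qed

lemma cong_half:
  assumes "int k dvd x - y"
  shows "[x = y] (mod int (2 * k)) \<or> [x = y + int k] (mod int (2 * k))"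
proof -
  obtain t where t: "x - y = int k * t" using assms by (rule dvdE)
  show ?thesis
  proof (cases "even t")
    case True
    then obtain s where "t = 2 * s" by blast
    then have "x - y = int (2 * k) * s" using t by simp
    then show ?thesis by (simp add: cong_iff_dvd_diff)
  next
    case False
    then obtain s where "t = 2 * s + 1" by (rule oddE)
    then have "x - (y + int k) = int (2 * k) * s" using t by (simp add: algebra_simps)
    then show ?thesis by (metis cong_iff_dvd_diff dvd_triv_left)
  qed
qed

text \<open>Links the description by apex and leg, convenient for algebra, with the six edges of the
  list, needed for the link.\<close>

lemma iso_adj_iff: "iso_adj k a p q \<longleftrightarrow> cyc_adj (2 * k) (iso_hexagon k a) p q"
proof
  let ?P = "pair_cong (2 * k)"
  assume "cyc_adj (2 * k) (iso_hexagon k a) p q"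
  moreover have *: "iso_adj k a p q" if "?P p q u v" "iso_adj k a u v" for u v
    using that(1) iso_adj_cong[OF cong_sym cong_sym that(2)]
      iso_adj_cong[OF cong_sym cong_sym iso_adj_sym[OF that(2)]] unfolding pair_cong_def by blast
  moreover have "iso_adj k a a (2 * a)" "iso_adj k a (2 * a) (a + int k)"
    "iso_adj k a (a + int k) (- a - int k)" "iso_adj k a (- a - int k) (- 2 * a)"
    "iso_adj k a (- 2 * a) (- a)" "iso_adj k a (- a) a"
    by (auto simp: iso_adj_def)
  ultimately show "iso_adj k a p q" unfolding cyc_adj_iso_hexagon by blast
next
  let ?P = "pair_cong (2 * k)" and ?C = "\<lambda>x y. [x = y] (mod int (2 * k))"
  \<comment> \<open>The residue \<open>- a + int k\<close> is listed as \<open>- a - int k\<close>,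
    which is the same modulo \<open>2 * k\<close>.\<close>
  have half: "?C x a \<or> ?C x (a + int k) \<or> ?C x (- a) \<or> ?C x (- a - int k)"
    if "int k dvd x - a \<or> int k dvd x + a" for x
  proof -
    have "?C (- a + int k) (- a - int k)" by (simp add: cong_iff_dvd_diff)
    then show ?thesis using that cong_half[of k x a] cong_half[of k x "- a"] cong_trans by auto
  qed
  \<comment> \<open>Doubling a leg forgets the summand \<open>k\<close>: the legs \<open>a\<close>
    and \<open>a + int k\<close> both lead to \<open>2 * a\<close>, where the two kinds of isosceles
    triangle meet.\<close>
  have tw: "?C x (2 * a) \<and> (?C y a \<or> ?C y (a + int k)) \<or> ?C x (- 2 * a) \<and> (?C y (- a) \<or> ?C y (- a - int k))"
    if "2 * int k dvd x - 2 * y" "int k dvd y - a \<or> int k dvd y + a" for x y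
  proof -
    have c: "?C x (2 * y)" using that(1) by (simp add: cong_iff_dvd_diff)
    have "?C (2 * (a + int k)) (2 * a)" "?C (2 * (- a - int k)) (- 2 * a)" by (simp_all add: cong_iff_dvd_diff)
    moreover have "?C (2 * - a) (- 2 * a)" by simp
    moreover have "?C x w" if "?C y z" "?C (2 * z) w" for z w
      using c cong_scalar_left[OF that(1), of 2] that(2) by (meson cong_trans)
    ultimately show ?thesis using half[OF that(2)] cong_refl by blast
  qed
  assume "iso_adj k a p q"
  then consider "2 * int k dvd p + q" "int k dvd p - a \<or> int k dvd p + a"
    | "2 * int k dvd q - 2 * p" "int k dvd p - a \<or> int k dvd p + a"
    | "2 * int k dvd p - 2 * q" "int k dvd q - a \<or> int k dvd q + a"
    unfolding iso_adj_def by blast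
  then show "cyc_adj (2 * k) (iso_hexagon k a) p q"
  proof cases
    case 1
    have c: "?C q (- p)" using 1(1) by (simp add: cong_iff_dvd_diff add.commute)
    have "?C q (- z)" if "?C p z" for z
      using c that cong_trans cong_minus_minus_iff by blast
    then show ?thesis using half[OF 1(2)] unfolding cyc_adj_iso_hexagon pair_cong_def
      by (metis minus_minus minus_add_distrib minus_diff_eq diff_minus_eq_add uminus_add_conv_diff add.commute)
  next
    case 2
    show ?thesis using tw[OF 2] unfolding cyc_adj_iso_hexagon pair_cong_def by blast
  next
    case 3
    show ?thesis using tw[OF 3] unfolding cyc_adj_iso_hexagon pair_cong_def by blast
  qed
qed

text \<open>Up to sign, the differences of entries are k, a, 2a, 3a, 4a, a - k, 2a + k, 3a + k and
  2a + 2k. For 4a a factor 2 cancels against the modulus; all others except k are not even multiples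
  of k.\<close>

lemma circulant_iso_hexagon:
  assumes k: "k > 0" and a2: "\<not> int k dvd 2 * a" and a3: "\<not> int k dvd 3 * a"
  shows "circulant (2 * k) 1 0 (iso_adj k a) (iso_hexagon k a)"
proof
  let ?h = "iso_hexagon k a" and ?n = "2 * int k"
  have a1: "\<not> int k dvd a" using a2 by (metis dvd_mult)
  show "2 * k > 0" using k by simp
  show "3 \<le> length ?h" by (simp add: iso_hexagon_def)
  have ak: "\<not> int k dvd a + int k" "\<not> int k dvd - a - int k" using a1
    by (simp, metis add.commute dvd_add_triv_right_iff dvd_minus_iff minus_add_distrib uminus_add_conv_diff)
  have nd: "\<not> ?n dvd a" "\<not> ?n dvd 2 * a" "\<not> ?n dvd a + int k" "\<not> ?n dvd - a - int k" 
    using a1 a2 ak not_dvd_2k by blast+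
  show "\<not> int (2 * k) dvd h" if "h \<in> set ?h" for h
    using that nd by (auto simp: iso_hexagon_def)
  have kk: "\<not> ?n dvd int k" using k by (auto dest: zdvd_imp_le)
  have n3: "\<not> ?n dvd 3 * a" using a3 not_dvd_2k by blast
  have nk1: "\<not> ?n dvd a - int k" and nk2: "\<not> ?n dvd 2 * a + int k" and nk3: "\<not> ?n dvd 3 * a + int k"
    and nk4: "\<not> ?n dvd 2 * a + 2 * int k"
  proof -
    have "\<not> int k dvd a - int k" using a1 by (metis diff_add_cancel dvd_add_triv_right_iff)
    then show "\<not> ?n dvd a - int k" by (rule not_dvd_2k)
    show "\<not> ?n dvd 2 * a + int k" "\<not> ?n dvd 3 * a + int k" using a2 a3 by (auto intro!: not_dvd_2k)
    have "\<not> int k dvd 2 * a + 2 * int k" using a2 by (simp add: dvd_add_left_iff)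
    then show "\<not> ?n dvd 2 * a + 2 * int k" by (rule not_dvd_2k)
  qed
  have a4: "\<not> ?n dvd 4 * a" using a2 dvd_double[of k "2 * a"] by simp
  have "distinct (map (\<lambda>h. h mod ?n) ?h)"
    unfolding iso_hexagon_def
    by (simp only: list.map distinct.simps list.set insert_iff empty_iff mod_eq_dvd_iff de_Morgan_disj
        not_False_eq_True simp_thms; intro conjI;
        ((rule not_dvd_upto_sign[OF kk], (simp; fail)) |
        (rule not_dvd_upto_sign[OF nd(1)], (simp; fail)) |
        (rule not_dvd_upto_sign[OF nd(2)], (simp; fail)) |
        (rule not_dvd_upto_sign[OF n3], (simp; fail)) |
        (rule not_dvd_upto_sign[OF a4], (simp; fail)) |
        (rule not_dvd_upto_sign[OF nk1], (simp; fail)) |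
        (rule not_dvd_upto_sign[OF nk2], (simp; fail)) |
        (rule not_dvd_upto_sign[OF nk3], (simp; fail)) |
        (rule not_dvd_upto_sign[OF nk4], (simp; fail))))
  then show "distinct (map (\<lambda>h. h mod int (2 * k)) ?h)" by simp
  show "iso_adj k a p q \<longleftrightarrow> (\<exists>i<length ?h.
     [p = ?h ! i] (mod int (2 * k)) \<and> [q = ?h ! (Suc i mod length ?h)] (mod int (2 * k)) \<or>
     [q = ?h ! i] (mod int (2 * k)) \<and> [p = ?h ! (Suc i mod length ?h)] (mod int (2 * k)))" for p q
    unfolding iso_adj_iff by (rule cyc_adj_def)
  show "iso_adj k a (- p) (q - p)" if "iso_adj k a p q" for p q
    using that by (rule iso_adj_base)
qed auto

section \<open>The decomposition\<close>

lemma dvd_diff_iff_diagonal: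
  fixes x y k :: nat
  assumes "x < 2 * k" "y < 2 * k"
  shows "int k dvd int y - int x \<longleftrightarrow> y = x \<or> y = x + k \<or> x = y + k"
proof
  assume "int k dvd int y - int x"
  then obtain t where t: "int y - int x = int k * t" by (rule dvdE)
  have "\<bar>int k * t\<bar> < int k * 2" using assms t by linarith
  moreover have "int k > 0" using assms by simp
  ultimately have "\<bar>t\<bar> < 2" by (simp add: abs_mult)
  then consider "t = 0" | "t = 1" | "t = - 1" by linarith
  then show "y = x \<or> y = x + k \<or> x = y + k" using t by cases auto
qed auto

lemma valid_iff_no_diagonal:
  assumes "x < 2 * k" "y < 2 * k" "z < 2 * k"
  shows "valid k (int y - int x) (int z - int x) \<longleftrightarrow>
    x \<noteq> y \<and> x \<noteq> z \<and> y \<noteq> z \<and> (\<forall>i<k. \<not> {i, k + i} \<subseteq> {x, y, z})"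
proof -
  have *: "\<not> int k dvd int b - int a \<longleftrightarrow> a \<noteq> b \<and> \<not> (\<exists>i<k. a = i \<and> b = k + i \<or> b = i \<and> a = k + i)"
    if "a < 2 * k" "b < 2 * k" for a b
    using that by (auto simp: dvd_diff_iff_diagonal)
  have "valid k (int y - int x) (int z - int x) \<longleftrightarrow>
     \<not> int k dvd int y - int x \<and> \<not> int k dvd int z - int x \<and> \<not> int k dvd int z - int y"
    by (simp add: valid_def)
  also have "\<dots> \<longleftrightarrow> x \<noteq> y \<and> x \<noteq> z \<and> y \<noteq> z \<and> (\<forall>i<k. \<not> {i, k + i} \<subseteq> {x, y, z})"
    unfolding *[OF assms(1,2)] *[OF assms(1,3)] *[OF assms(2,3)] by auto
  finally show ?thesis .
qed

text \<open>A set without diagonals extends to a facet by choosing one end of each diagonal that it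
  misses.\<close>

lemma cross_boundary_alt:
  "cross_boundary k = {s. s \<noteq> {} \<and> s \<subseteq> {0..<2 * k} \<and> (\<forall>i<k. \<not> {i, k + i} \<subseteq> s)}" (is "_ = ?B")
proof
  show "cross_boundary k \<subseteq> ?B"
    unfolding cross_boundary_def cross_facets_def by blast
  show "?B \<subseteq> cross_boundary k"
  proof
    fix s assume s: "s \<in> ?B"
    \<comment> \<open>The smaller label \<open>i\<close> is chosen from each missed diagonal. Then
      \<open>t\<close> meets every diagonal once, and reduction modulo \<open>k\<close> maps it
      bijectively onto \<open>{..<k}\<close>.\<close>
    define t where "t = s \<union> {i. i < k \<and> i \<notin> s \<and> k + i \<notin> s}"
    have t: "t \<subseteq> {0..<2 * k}" using s by (auto simp: t_def)
    have nd: "\<not> {i, k + i} \<subseteq> t" if "i < k" for i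
      using s that by (auto simp: t_def)
    have "inj_on (\<lambda>x. x mod k) t"
    proof (rule inj_onI)
      fix x y assume xy: "x \<in> t" "y \<in> t" "x mod k = y mod k"
      then have less: "x < 2 * k" "y < 2 * k" using t by auto
      have "int k dvd int y - int x"
        using xy(3) by (metis mod_eq_dvd_iff zmod_int)
      then have "y = x \<or> y = x + k \<or> x = y + k"
        using dvd_diff_iff_diagonal[of x k y] less by blast
      moreover have "y \<noteq> x + k" "x \<noteq> y + k"
        using nd[of x] nd[of y] xy less by (auto simp: add.commute)
      ultimately show "x = y" by simp
    qed
    moreover have "(\<lambda>x. x mod k) ` t = {..<k}"
    proof
      show "(\<lambda>x. x mod k) ` t \<subseteq> {..<k}" using t by (auto intro!: mod_less_divisor)
      show "{..<k} \<subseteq> (\<lambda>x. x mod k) ` t"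
      proof
        fix i assume "i \<in> {..<k}"
        then have "i \<in> t \<or> k + i \<in> t" "i mod k = i" "(k + i) mod k = i" by (auto simp: t_def)
        then show "i \<in> (\<lambda>x. x mod k) ` t" by (metis image_eqI)
      qed
    qed
    ultimately have "card t = k" using card_image by fastforce
    then have "t \<in> cross_facets k" using t nd by (simp add: cross_facets_def)
    then show "s \<in> cross_boundary k" using s by (auto simp: cross_boundary_def t_def)
  qed
qed

lemma circ_faces_subset_skel2:
  assumes "\<And>p q. R p q \<Longrightarrow> valid k p q"
  shows "circ_faces (2 * k) m j R \<subseteq> cross_skel2 k"
proof
  fix s assume "s \<in> circ_faces (2 * k) m j R"
  then obtain x y z where *: "s \<noteq> {}" "x < 2 * k" "y < 2 * k" "z < 2 * k" "s \<subseteq> {x, y, z}"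
    and R: "R (int y - int x) (int z - int x)"
    unfolding circ_faces_def by blast
  then have "\<forall>i<k. \<not> {i, k + i} \<subseteq> {x, y, z}"
    using assms[OF R] valid_iff_no_diagonal[OF *(2-4)] by blast
  then have "\<forall>i<k. \<not> {i, k + i} \<subseteq> s" using *(5) by (meson subset_trans)
  moreover have "s \<subseteq> {0..<2 * k}" using * by auto
  moreover have "card s \<le> 3"
    using card_mono[OF _ *(5)] by (auto simp: card_insert_if split: if_splits)
  ultimately show "s \<in> cross_skel2 k"
    using *(1) unfolding cross_skel2_def skeleton_def face_dim_def cross_boundary_alt by auto
qed

lemma skel2_triangleE:
  assumes "t \<in> cross_skel2 k" "face_dim t = 2"
  obtains x y z where "t = {x, y, z}" "x < 2 * k" "y < 2 * k" "z < 2 * k"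
    "x \<noteq> y" "x \<noteq> z" "y \<noteq> z" "valid k (int y - int x) (int z - int x)"
proof -
  have "card t = 3" using assms(2) by (simp add: face_dim_def)
  then obtain x y z where t: "t = {x, y, z}" "x \<noteq> y" "x \<noteq> z" "y \<noteq> z"
    by (auto simp: card_3_iff)
  have tt: "t \<subseteq> {0..<2 * k}" "\<forall>i<k. \<not> {i, k + i} \<subseteq> t"
    using assms(1) by (auto simp: cross_skel2_def skeleton_def cross_boundary_alt)
  then have xyz: "x < 2 * k" "y < 2 * k" "z < 2 * k" using t(1) by auto
  then have "valid k (int y - int x) (int z - int x)"
    using valid_iff_no_diagonal[OF xyz] tt(2) t by blast
  with that t xyz show thesis by blast
qed

section \<open>The octahedra\<close>

text \<open>These are the multiples of \<open>m\<close> modulo \<open>6 * m\<close> other than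
  \<open>0\<close> and its antipode, ordered so that the antipodal pairs \<open>m\<close>,
  \<open>- 2 * m\<close> and \<open>2 * m\<close>, \<open>- m\<close> are not consecutive.\<close>

definition oct_cycle :: "nat \<Rightarrow> int list" where
  "oct_cycle m = [int m, 2 * int m, - 2 * int m, - int m]"

lemma cyc_adj_oct_cycle:
  "cyc_adj n (oct_cycle m) p q \<longleftrightarrow>
     pair_cong n p q (int m) (2 * int m) \<or> pair_cong n p q (2 * int m) (- 2 * int m) \<or>
     pair_cong n p q (- 2 * int m) (- int m) \<or> pair_cong n p q (- int m) (int m)"
proof -
  have len: "length (oct_cycle m) = 4" by (simp add: oct_cycle_def)
  show ?thesis unfolding cyc_adj_def len ex_less_4 by (simp add: oct_cycle_def pair_cong_def)
qed

text \<open>If \<open>m\<close> divides \<open>p\<close> and \<open>q\<close>, dividing by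
  \<open>m\<close> leaves a statement about residues modulo 6; otherwise both sides are
  false.\<close>

lemma oct_adj_iff:
  assumes m: "m > 0"
  shows "oct_adj (3 * m) p q \<longleftrightarrow> cyc_adj (2 * (3 * m)) (oct_cycle m) p q"
proof (cases "int m dvd p \<and> int m dvd q")
  case True
  then obtain p' q' where p: "p = int m * p'" and q: "q = int m * q'" by blast
  have c: "[int m * x = int m * y] (mod int (2 * (3 * m))) \<longleftrightarrow> 6 dvd x - y" for x y
  proof -
    have "[int m * x = int m * y] (mod int (2 * (3 * m))) \<longleftrightarrow> int m * 6 dvd int m * (x - y)"
      by (simp add: cong_iff_dvd_diff algebra_simps)
    then show ?thesis using m by simp
  qed
  have e: "int m = int m * 1" "2 * int m = int m * 2" "- 2 * int m = int m * (- 2)" "- int m = int m * (- 1)" by simp_all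
  have pc: "pair_cong (2 * (3 * m)) p q (int m * u) (int m * v) \<longleftrightarrow>
      6 dvd p' - u \<and> 6 dvd q' - v \<or> 6 dvd q' - u \<and> 6 dvd p' - v" for u v
    unfolding pair_cong_def p q c ..
  have d: "int (3 * m) dvd int m * x \<longleftrightarrow> 3 dvd x" for x
    using m by (simp add: mult.commute)
  have "q - p = int m * (q' - p')" by (simp add: p q algebra_simps)
  then have "oct_adj (3 * m) p q \<longleftrightarrow> \<not> 3 dvd p' \<and> \<not> 3 dvd q' \<and> \<not> 3 dvd q' - p'"
    unfolding oct_adj_def valid_def using d[of p'] d[of q'] d[of "q' - p'"] by (simp add: p q)
  also have "\<dots> \<longleftrightarrow> cyc_adj (2 * (3 * m)) (oct_cycle m) p q"
    unfolding cyc_adj_oct_cycle e(2-4) pc pc[of 1, unfolded mult_1_right] pc[of _ 1, unfolded mult_1_right]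
    by presburger
  finally show ?thesis .
next
  case False
  have d: "int m dvd 2 * (3 * int m)" by simp
  have "\<not> pair_cong (2 * (3 * m)) p q (int m * u) (int m * v)" for u v
  proof
    assume "pair_cong (2 * (3 * m)) p q (int m * u) (int m * v)"
    then have "pair_cong m p q (int m * u) (int m * v)"
      unfolding pair_cong_def using cong_dvd_modulus[of _ _ "int (2 * (3 * m))" "int m"] by auto
    then show False using False unfolding pair_cong_def by (auto simp: cong_dvd_iff)
  qed
  from this[of 1 2] this[of 2 "- 2"] this[of "- 2" "- 1"] this[of "- 1" 1]
  have "\<not> cyc_adj (2 * (3 * m)) (oct_cycle m) p q"
    unfolding cyc_adj_oct_cycle by (simp add: mult.commute)
  moreover have "\<not> oct_adj (3 * m) p q" using False by (auto simp: oct_adj_def)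
  ultimately show ?thesis by simp
qed

lemma circulant_oct:
  assumes j: "j < m"
  shows "circulant (2 * (3 * m)) m j (oct_adj (3 * m)) (oct_cycle m)"
proof
  let ?h = "oct_cycle m"
  have m: "m > 0" using j by simp
  show "0 < 2 * (3 * m)" "m dvd 2 * (3 * m)" "j < m" using m j by auto
  show "3 \<le> length ?h" by (simp add: oct_cycle_def)
  show "int m dvd h" if "h \<in> set ?h" for h using that by (auto simp: oct_cycle_def)
  have nd: "\<not> int (2 * (3 * m)) dvd int m * u" if "\<not> 6 dvd u" for u
  proof -
    have "int (2 * (3 * m)) dvd int m * u \<longleftrightarrow> int m * 6 dvd int m * u" by (simp add: mult.commute)
    then show ?thesis using m that by simp
  qed
  show "\<not> int (2 * (3 * m)) dvd h" if "h \<in> set ?h" for h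
    using that nd[of 1] nd[of 2] nd[of "-2"] nd[of "-1"] by (auto simp: oct_cycle_def mult.commute)
  show "distinct (map (\<lambda>h. h mod int (2 * (3 * m))) ?h)"
    unfolding oct_cycle_def
    by (simp only: list.map distinct.simps list.set insert_iff empty_iff mod_eq_dvd_iff de_Morgan_disj
        not_False_eq_True simp_thms; intro conjI;
        ((rule not_dvd_upto_sign[OF nd[of 1]], simp, simp; fail) |
         (rule not_dvd_upto_sign[OF nd[of 2]], simp, simp; fail) |
         (rule not_dvd_upto_sign[OF nd[of 3]], simp, simp; fail) |
         (rule not_dvd_upto_sign[OF nd[of 4]], simp, simp; fail)))
  show "oct_adj (3 * m) p q \<longleftrightarrow> (\<exists>i<length ?h.
     [p = ?h ! i] (mod int (2 * (3 * m))) \<and> [q = ?h ! (Suc i mod length ?h)] (mod int (2 * (3 * m))) \<or>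
     [q = ?h ! i] (mod int (2 * (3 * m))) \<and> [p = ?h ! (Suc i mod length ?h)] (mod int (2 * (3 * m))))" for p q
    unfolding oct_adj_iff[OF m] by (rule cyc_adj_def)
  show "oct_adj (3 * m) (- p) (q - p)" if "oct_adj (3 * m) p q" for p q
    using that by (auto simp: oct_adj_def valid_def algebra_simps intro: dvd_diff)
qed

section \<open>The two families of surfaces\<close>

text \<open>A set of relations rather than of parameters, so that parameters giving the same
  relation count once.\<close>

definition torus_adjs :: "nat \<Rightarrow> (int \<Rightarrow> int \<Rightarrow> bool) set" where
  "torus_adjs k =
     {cyc_adj (2 * k) (hexagon a b) | a b. valid k a b \<and> \<not> isosceles k a b} \<union>
     {iso_adj k a | a. \<not> int k dvd 2 * a \<and> \<not> int k dvd 3 * a}"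

definition tori :: "nat \<Rightarrow> nat set set set" where
  "tori k = circ_faces (2 * k) 1 0 ` torus_adjs k"

text \<open>All octahedra have the same relation and differ only in their residue class.\<close>

definition octahedra :: "nat \<Rightarrow> nat set set set" where
  "octahedra k = (if 3 dvd k then (\<lambda>j. circ_faces (2 * k) (k div 3) j (oct_adj k)) ` {..<k div 3} else {})"

lemma torus_circulant:
  assumes "k > 0" "R \<in> torus_adjs k"
  obtains hs where "circulant (2 * k) 1 0 R hs" "length hs = 6"
proof -
  consider a b where "R = cyc_adj (2 * k) (hexagon a b)" "valid k a b" "\<not> isosceles k a b"
    | a where "R = iso_adj k a" "\<not> int k dvd 2 * a" "\<not> int k dvd 3 * a"
    using assms(2) unfolding torus_adjs_def by blast
  then show thesis
    using that circulant_hexagon[OF assms(1)] circulant_iso_hexagon[OF assms(1)]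
      length_hexagon length_iso_hexagon by cases metis+
qed

lemma not_dvd_shift:
  fixes n x y :: int
  assumes "\<not> n dvd x" "n dvd y - x \<or> n dvd y + x"
  shows "\<not> n dvd y"
proof
  assume "n dvd y"
  moreover have "x = y - (y - x)" "x = (y + x) - y" by simp_all
  ultimately show False using assms by (metis dvd_diff)
qed

section \<open>Every valid pair satisfies exactly one relation\<close>

text \<open>Modulo \<open>k\<close>, the differences belonging to each edge of the list are
  \<open>a\<close> or \<open>2 * a\<close> up to sign.\<close>

lemma iso_adj_valid:
  assumes a2: "\<not> int k dvd 2 * a" and iso: "iso_adj k a p q"
  shows "valid k p q"
proof -
  have a1: "\<not> int k dvd a" using a2 by (metis dvd_mult)
  have "valid k p q" if "pair_cong (2 * k) p q u v" "valid k u v" for u v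
    using that(1) valid_cong[OF cong_sym cong_sym that(2)]
      valid_cong[OF cong_sym cong_sym valid_swap[OF that(2)]] unfolding pair_cong_def by blast
  moreover have "valid k a (2 * a)" "valid k (2 * a) (a + int k)"
    "valid k (a + int k) (- a - int k)" "valid k (- a - int k) (- 2 * a)"
    "valid k (- 2 * a) (- a)" "valid k (- a) a"
    unfolding valid_def
    by (intro conjI; ((rule not_dvd_shift[OF a1], simp; fail) | (rule not_dvd_shift[OF a2], simp; fail)))+
  ultimately show ?thesis using iso unfolding iso_adj_iff cyc_adj_iso_hexagon by blast
qed

text \<open>One of \<open>p\<close> and \<open>q\<close> is a leg, hence \<open>a\<close> up to sign
  modulo \<open>k\<close>.\<close>

lemma iso_adj_not_oct:
  assumes a3: "\<not> int k dvd 3 * a" and iso: "iso_adj k a p q"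
  shows "\<not> (int k dvd 3 * p \<and> int k dvd 3 * q)"
proof -
  have *: "\<not> int k dvd 3 * x" if "int k dvd x - a \<or> int k dvd x + a" for x
  proof
    assume x: "int k dvd 3 * x"
    have "3 * a = 3 * x - 3 * (x - a)" "3 * a = 3 * (x + a) - 3 * x" by simp_all
    then show False using that x a3 by (metis dvd_diff dvd_mult)
  qed
  show ?thesis using iso * unfolding iso_adj_def by blast
qed

text \<open>If 3 did not divide \<open>k\<close>, then \<open>k\<close> would divide
  \<open>p\<close> itself. After division by \<open>m\<close> the corners are residues modulo 6,
  pairwise incongruent modulo 3, and such a triple is always isosceles. So no generic hexagon
  contains an octahedral pair.\<close>

lemma oct_isosceles:
  assumes "oct_adj k p q" shows "3 dvd k" "isosceles k p q"
proof -
  have v: "valid k p q" and d: "int k dvd 3 * p" "int k dvd 3 * q" using assms by (auto simp: oct_adj_def)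
  show 3: "3 dvd k"
  proof (rule ccontr)
    assume "\<not> 3 dvd k"
    then have "coprime (int k) 3"
      using prime_imp_coprime[of "3 :: nat" k] by (simp add: coprime_commute flip: coprime_int_iff)
    then show False using v d(1) by (simp add: coprime_dvd_mult_right_iff valid_def)
  qed
  then obtain m where k: "k = 3 * m" by blast
  have m: "m > 0" using v d(1) by (cases "m = 0") (auto simp: k valid_def)
  obtain p' q' where p: "p = int m * p'" and q: "q = int m * q'"
  proof -
    have "int m dvd p" "int m dvd q" using d by (auto simp: k)
    with that show thesis unfolding dvd_def by blast
  qed
  have d3: "int k dvd int m * x \<longleftrightarrow> 3 dvd x" and d6: "2 * int k dvd int m * x \<longleftrightarrow> 6 dvd x" for x
  proof -
    have "int k = int m * 3" "2 * int k = int m * 6" by (simp_all add: k)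
    then show "int k dvd int m * x \<longleftrightarrow> 3 dvd x" "2 * int k dvd int m * x \<longleftrightarrow> 6 dvd x"
      using m by (metis dvd_times_left_cancel_iff of_nat_0_eq_iff not_gr_zero)+
  qed
  have "q - p = int m * (q' - p')" "p + q = int m * (p' + q')" "q - 2 * p = int m * (q' - 2 * p')"
    "p - 2 * q = int m * (p' - 2 * q')"
    by (simp_all add: p q algebra_simps)
  moreover have "\<not> 3 dvd p'" "\<not> 3 dvd q'" "\<not> 3 dvd q' - p'"
    using v d3 calculation(1) unfolding valid_def p q by metis+
  then have "6 dvd p' + q' \<or> 6 dvd q' - 2 * p' \<or> 6 dvd p' - 2 * q'" by presburger
  ultimately show "isosceles k p q" unfolding isosceles_def by (metis d6)
qed

lemma torus_valid:
  assumes "R \<in> torus_adjs k" "R p q"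
  shows "valid k p q" "\<not> oct_adj k p q"
proof -
  consider (hexagon) a b where "R = cyc_adj (2 * k) (hexagon a b)" "valid k a b" "\<not> isosceles k a b"
    | (iso) a where "R = iso_adj k a" "\<not> int k dvd 2 * a" "\<not> int k dvd 3 * a"
    using assms(1) unfolding torus_adjs_def by blast
  then have "valid k p q \<and> \<not> oct_adj k p q"
  proof cases
    case hexagon
    then show ?thesis
      using assms(2) hexagon_adj_valid hexagon_adj_not_isosceles oct_isosceles(2) by blast
  next
    case iso
    then show ?thesis
      using assms(2) iso_adj_valid iso_adj_not_oct unfolding oct_adj_def by blast
  qed
  then show "valid k p q" "\<not> oct_adj k p q" by auto
qed

lemma iso_adj_isosceles: "iso_adj k a p q \<Longrightarrow> isosceles k p q"
  by (auto simp: iso_adj_def isosceles_def)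

text \<open>The apex is unique, so both parameters describe the same leg \<open>x\<close>. Hence
  \<open>a\<close> and \<open>b\<close> agree up to sign modulo \<open>k\<close>, and
  \<open>iso_adj\<close> depends on nothing more.\<close>

lemma iso_adj_determines:
  assumes a: "\<not> int k dvd 3 * a" "iso_adj k a p q" and b: "iso_adj k b p q"
  shows "iso_adj k a = iso_adj k b"
proof -
  have no: "\<not> (int k dvd 3 * p \<and> int k dvd 3 * q)" using iso_adj_not_oct a by blast
  have k2: "int k dvd x" if "2 * int k dvd x" for x using that by (rule dvd_mult_right)
  \<comment> \<open>Two apexes would make the triangle equilateral, with \<open>3 * p\<close> and
    \<open>3 * q\<close> multiples of \<open>k\<close>.\<close>
  have excl: "\<not> (2 * int k dvd p + q \<and> 2 * int k dvd q - 2 * p)"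
    "\<not> (2 * int k dvd p + q \<and> 2 * int k dvd p - 2 * q)"
    "\<not> (2 * int k dvd q - 2 * p \<and> 2 * int k dvd p - 2 * q)"
  proof -
    have f: False if "int k dvd 3 * p" "int k dvd 3 * q" using no that by blast
    have e: "3 * p = (p + q) - (q - 2 * p)" "3 * q = 2 * (p + q) + (q - 2 * p)"
      "3 * p = 2 * (p + q) + (p - 2 * q)" "3 * q = (p + q) - (p - 2 * q)"
      "3 * p = - (2 * (q - 2 * p)) - (p - 2 * q)" "3 * q = - (q - 2 * p) - 2 * (p - 2 * q)" by simp_all
    show "\<not> (2 * int k dvd p + q \<and> 2 * int k dvd q - 2 * p)"
      using f k2 e(1,2) by (metis dvd_diff dvd_add dvd_mult)
    show "\<not> (2 * int k dvd p + q \<and> 2 * int k dvd p - 2 * q)"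
      using f k2 e(3,4) by (metis dvd_diff dvd_add dvd_mult)
    show "\<not> (2 * int k dvd q - 2 * p \<and> 2 * int k dvd p - 2 * q)"
      using f k2 e(5,6) by (metis dvd_diff dvd_add dvd_mult dvd_minus_iff)
  qed
  obtain x where x: "int k dvd x - a \<or> int k dvd x + a" "int k dvd x - b \<or> int k dvd x + b"
    using a(2) b excl unfolding iso_adj_def by blast
  have "int k dvd a - b \<or> int k dvd a + b"
  proof -
    have "a - b = (x - b) - (x - a)" "a + b = (x + b) - (x - a)" "a + b = (x + a) - (x - b)" "a - b = (x + a) - (x + b)"
      by simp_all
    then show ?thesis using x by (metis dvd_diff)
  qed
  then have "int k dvd y - a \<or> int k dvd y + a \<longleftrightarrow> int k dvd y - b \<or> int k dvd y + b" for y
  proof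
    assume d: "int k dvd a - b"
    have "y - b = (y - a) + (a - b)" "y + a = (y + b) + (a - b)" by simp_all
    then show ?thesis using d by (metis dvd_add_left_iff)
  next
    assume d: "int k dvd a + b"
    have "y + b = (y - a) + (a + b)" "y + a = (y - b) + (a + b)" by simp_all
    then show ?thesis using d by (metis dvd_add_left_iff)
  qed
  then show ?thesis unfolding iso_adj_def fun_eq_iff by blast
qed

text \<open>Hexagon relations hold only at non-isosceles pairs, \<open>iso_adj\<close> only at
  isosceles ones; within each kind one pair determines the relation.\<close>

lemma torus_adj_unique:
  assumes "R \<in> torus_adjs k" "R' \<in> torus_adjs k" "R p q" "R' p q"
  shows "R = R'"
  using assms hexagon_adj_not_isosceles iso_adj_isosceles iso_adj_determines cyc_adj_hexagon_eq
  unfolding torus_adjs_def by (elim UnE CollectE exE conjE) (metis+)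

lemma hexagon_self: "cyc_adj n (hexagon p q) p q"
  by (simp add: cyc_adj_hexagon pair_cong_def)

text \<open>A non-isosceles pair generates its own hexagon. Otherwise \<open>a\<close> is the leg:
  modulo \<open>k\<close> the base is \<open>2 * a\<close> up to sign, so validity keeps
  \<open>k\<close> from dividing \<open>2 * a\<close>, and the failure of \<open>oct_adj\<close>
  keeps it from dividing \<open>3 * a\<close>.\<close>

lemma torus_adj_exists:
  assumes v: "valid k p q" and no: "\<not> oct_adj k p q"
  shows "\<exists>R\<in>torus_adjs k. R p q"
proof (cases "isosceles k p q")
  case False
  then have "cyc_adj (2 * k) (hexagon p q) \<in> torus_adjs k" using v by (auto simp: torus_adjs_def)
  then show ?thesis using hexagon_self by blast
next
  case True
  have k2: "int k dvd x" if "2 * int k dvd x" for x using that by (rule dvd_mult_right)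
  have nv: "\<not> int k dvd p" "\<not> int k dvd q" "\<not> int k dvd q - p" using v by (auto simp: valid_def)
  have no3: "\<not> (int k dvd 3 * p \<and> int k dvd 3 * q)" using v no by (simp add: oct_adj_def)
  have "\<exists>a. \<not> int k dvd 2 * a \<and> \<not> int k dvd 3 * a \<and> iso_adj k a p q"
    using True unfolding isosceles_def
  proof (elim disjE)
    assume d: "2 * int k dvd p + q"
    have "q - p = (p + q) - 2 * p" "3 * q = 3 * (p + q) - 3 * p" by simp_all
    then have "\<not> int k dvd 2 * p" "\<not> int k dvd 3 * p"
      using k2[OF d] nv no3 by (metis dvd_diff dvd_mult)+
    then show ?thesis using d by (auto simp: iso_adj_def)
  next
    assume d: "2 * int k dvd q - 2 * p"
    have "q = (q - 2 * p) + 2 * p" "3 * q = 3 * (q - 2 * p) + 2 * (3 * p)" by simp_all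
    then have "\<not> int k dvd 2 * p" "\<not> int k dvd 3 * p"
      using k2[OF d] nv no3 by (metis dvd_add dvd_mult)+
    then show ?thesis using d by (auto simp: iso_adj_def)
  next
    assume d: "2 * int k dvd p - 2 * q"
    have "p = (p - 2 * q) + 2 * q" "3 * p = 3 * (p - 2 * q) + 2 * (3 * q)" by simp_all
    then have "\<not> int k dvd 2 * q" "\<not> int k dvd 3 * q"
      using k2[OF d] nv no3 by (metis dvd_add dvd_mult)+
    then show ?thesis using d by (auto simp: iso_adj_def)
  qed
  then show ?thesis unfolding torus_adjs_def by blast
qed

section \<open>From relations to the decomposition\<close>

lemma torus_triangle_iff:
  assumes "k > 0" "R \<in> torus_adjs k"
    and "x < 2 * k" "y < 2 * k" "z < 2 * k" "x \<noteq> y" "x \<noteq> z" "y \<noteq> z"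
  shows "{x, y, z} \<in> circ_faces (2 * k) 1 0 R \<longleftrightarrow> R (int y - int x) (int z - int x)"
proof -
  obtain hs where "circulant (2 * k) 1 0 R hs" using torus_circulant assms by blast
  then interpret circulant "2 * k" 1 0 R hs .
  show ?thesis unfolding triangle_in_iff[OF assms(3-)] vset_def using assms(3) by simp
qed

lemma oct_triangle_iff:
  assumes "j < m"
    and "x < 2 * (3 * m)" "y < 2 * (3 * m)" "z < 2 * (3 * m)" "x \<noteq> y" "x \<noteq> z" "y \<noteq> z"
  shows "{x, y, z} \<in> circ_faces (2 * (3 * m)) m j (oct_adj (3 * m)) \<longleftrightarrow>
    x mod m = j \<and> oct_adj (3 * m) (int y - int x) (int z - int x)"
proof -
  interpret circulant "2 * (3 * m)" m j "oct_adj (3 * m)" "oct_cycle m"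
    using circulant_oct assms(1) .
  show ?thesis unfolding triangle_in_iff[OF assms(2-)] vset_def using assms(2) by simp
qed

text \<open>The parameters range over infinitely many integers, so finiteness comes from the finite
  number of subsets of the skeleton.\<close>

lemma finite_circ_family:
  assumes "\<And>S. S \<in> F \<Longrightarrow> S \<subseteq> cross_skel2 k" shows "finite F"
proof -
  have "cross_skel2 k \<subseteq> Pow {0..<2 * k}"
    unfolding cross_skel2_def skeleton_def cross_boundary_alt by blast
  then have "finite (Pow (cross_skel2 k))" using finite_subset by auto
  then show ?thesis using assms finite_subset by (metis PowI subsetI)
qed

lemma tori_props:
  assumes k: "k > 0" and S: "S \<in> tori k"
  shows "closed_surface S" "S \<subseteq> cross_skel2 k" "vertex_transitive S" "euler_char S = 0" "card (vertices S) = 2 * k"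
proof -
  obtain R where R: "R \<in> torus_adjs k" "S = circ_faces (2 * k) 1 0 R" using S unfolding tori_def by blast
  obtain hs where "circulant (2 * k) 1 0 R hs" and l: "length hs = 6" using torus_circulant k R by blast
  then interpret circulant "2 * k" 1 0 R hs by simp
  show "closed_surface S" "vertex_transitive S" "euler_char S = 0"
    unfolding R using closed transitive euler_zero[OF l] by auto
  show "card (vertices S) = 2 * k" unfolding R vertices_K vset_def by simp
  show "S \<subseteq> cross_skel2 k" unfolding R using torus_valid(1) R by (intro circ_faces_subset_skel2)
qed

lemma octahedra_props:
  assumes S: "S \<in> octahedra k"
  shows "closed_surface S" "S \<subseteq> cross_skel2 k" "vertex_transitive S"
proof -
  obtain m where k: "k = 3 * m" using S by (auto simp: octahedra_def split: if_splits)
  obtain j where j: "j < m" and Sj: "S = circ_faces (2 * (3 * m)) m j (oct_adj (3 * m))"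
    using S by (auto simp: octahedra_def k)
  interpret circulant "2 * (3 * m)" m j "oct_adj (3 * m)" "oct_cycle m" using circulant_oct j .
  show "closed_surface S" "vertex_transitive S" unfolding Sj using closed transitive by auto
  show "S \<subseteq> cross_skel2 k" unfolding Sj k by (rule circ_faces_subset_skel2) (simp add: oct_adj_def)
qed

text \<open>The differences at a corner of a triangle select its surface: for an octahedral pair the
  residue of the corner selects the octahedron, and any other valid pair satisfies a unique relation
  in \<open>torus_adjs\<close>.\<close>

lemma decomposition:
  assumes k: "k > 0"
  shows "decomposes_into (cross_skel2 k) (octahedra k \<union> tori k)"
  unfolding decomposes_into_def
proof (intro conjI ballI impI)
  show "finite (octahedra k \<union> tori k)"
    using octahedra_props(2) tori_props(2)[OF k] finite_circ_family by (metis Un_iff)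
  show "closed_surface S" "S \<subseteq> cross_skel2 k" if "S \<in> octahedra k \<union> tori k" for S
    using that octahedra_props(1,2) tori_props(1,2)[OF k] by blast+
  fix t assume "t \<in> cross_skel2 k" "face_dim t = 2"
  then obtain x y z where t: "t = {x, y, z}" and xyz: "x < 2 * k" "y < 2 * k" "z < 2 * k"
    "x \<noteq> y" "x \<noteq> z" "y \<noteq> z" and v: "valid k (int y - int x) (int z - int x)"
    by (rule skel2_triangleE)
  let ?p = "int y - int x" and ?q = "int z - int x"
  have tor: "t \<in> circ_faces (2 * k) 1 0 R \<longleftrightarrow> R ?p ?q" if "R \<in> torus_adjs k" for R
    unfolding t using torus_triangle_iff[OF k that xyz] .
  show "\<exists>!S. S \<in> octahedra k \<union> tori k \<and> t \<in> S"
  proof (cases "oct_adj k ?p ?q")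
    case True
    then obtain m where km: "k = 3 * m" using oct_isosceles(1) by blast
    have m: "m > 0" using k km by simp
    let ?O = "\<lambda>j. circ_faces (2 * (3 * m)) m j (oct_adj (3 * m))"
    have o: "octahedra k = ?O ` {..<m}" by (simp add: octahedra_def km)
    have to: "t \<in> ?O j \<longleftrightarrow> x mod m = j" if "j < m" for j
      unfolding t using oct_triangle_iff[OF that xyz[unfolded km]] True km by simp
    have nt: "t \<notin> S" if "S \<in> tori k" for S
      using that tor torus_valid(2) True unfolding tori_def by blast
    show ?thesis
    proof (rule ex1I[of _ "?O (x mod m)"])
      show "?O (x mod m) \<in> octahedra k \<union> tori k \<and> t \<in> ?O (x mod m)"
        using to m unfolding o by auto
      show "S = ?O (x mod m)" if "S \<in> octahedra k \<union> tori k \<and> t \<in> S" for S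
        using that nt to unfolding o by auto
    qed
  next
    case False
    then obtain R where R: "R \<in> torus_adjs k" "R ?p ?q" using torus_adj_exists v by blast
    have no: "t \<notin> S" if S: "S \<in> octahedra k" for S
    proof -
      obtain m where km: "k = 3 * m" using S by (auto simp: octahedra_def split: if_splits)
      obtain j where j: "j < m" and Sj: "S = circ_faces (2 * (3 * m)) m j (oct_adj (3 * m))"
        using S by (auto simp: octahedra_def km)
      show ?thesis
        unfolding t Sj using oct_triangle_iff[OF j xyz[unfolded km]] False km by simp
    qed
    show ?thesis
    proof (rule ex1I[of _ "circ_faces (2 * k) 1 0 R"])
      show "circ_faces (2 * k) 1 0 R \<in> octahedra k \<union> tori k \<and> t \<in> circ_faces (2 * k) 1 0 R"
        using R tor unfolding tori_def by auto
      show "S = circ_faces (2 * k) 1 0 R" if "S \<in> octahedra k \<union> tori k \<and> t \<in> S" for S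
        using that no tor torus_adj_unique R unfolding tori_def by (smt (verit) Un_iff imageE)
    qed
  qed
qed

section \<open>Counting the surfaces of Euler characteristic 0\<close>

definition adj_pairs :: "nat \<Rightarrow> (int \<Rightarrow> int \<Rightarrow> bool) \<Rightarrow> (nat \<times> nat) set" where
  "adj_pairs n R = {(p, q). p < n \<and> q < n \<and> R (int p) (int q)}"

lemma finite_adj_pairs: "finite (adj_pairs n R)"
  by (rule finite_subset[of _ "{..<n} \<times> {..<n}"]) (auto simp: adj_pairs_def)

lemma card_torus_pairs:
  assumes "k > 0" "R \<in> torus_adjs k" shows "card (adj_pairs (2 * k) R) = 12"
proof -
  obtain hs where "circulant (2 * k) 1 0 R hs" and l: "length hs = 6" using torus_circulant assms by blast
  then interpret circulant "2 * k" 1 0 R hs by simp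
  show ?thesis using card_pairs l by (simp add: adj_pairs_def)
qed

lemma card_oct_pairs:
  assumes "k > 0" shows "card (adj_pairs (2 * k) (oct_adj k)) = (if 3 dvd k then 8 else 0)"
proof (cases "3 dvd k")
  case True
  then obtain m where km: "k = 3 * m" by blast
  have m: "0 < m" using assms km by simp
  interpret circulant "2 * (3 * m)" m 0 "oct_adj (3 * m)" "oct_cycle m" using circulant_oct m .
  show ?thesis using card_pairs by (simp add: adj_pairs_def km oct_cycle_def)
next
  case False
  then have "adj_pairs (2 * k) (oct_adj k) = {}"
    using oct_isosceles(1) unfolding adj_pairs_def by blast
  then show ?thesis using False by simp
qed

lemma card_valid_pairs:
  assumes "k \<ge> 3" shows "card (adj_pairs (2 * k) (valid k)) = (2 * k - 2) * (2 * k - 4)"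
proof -
  \<comment> \<open>The antipode of \<open>p\<close>: besides \<open>0\<close>, \<open>k\<close> and
    \<open>p\<close>, the vertex that \<open>q\<close> must avoid.\<close>
  define anti where "anti p = (if p < k then p + k else p - k)" for p
  have d0: "int k dvd int p \<longleftrightarrow> p = 0 \<or> p = k" if "p < 2 * k" for p
    using dvd_diff_iff_diagonal[of 0 k p] that assms by auto
  have d: "int k dvd int q - int p \<longleftrightarrow> q = p \<or> q = anti p" if "p < 2 * k" "q < 2 * k" for p q
    using dvd_diff_iff_diagonal[OF that] that by (auto simp: anti_def)
  have "adj_pairs (2 * k) (valid k) =
      Sigma ({..<2 * k} - {0, k}) (\<lambda>p. {..<2 * k} - {0, k, p, anti p})"
    by (auto simp: adj_pairs_def valid_def d0 d)
  moreover have "card ({..<2 * k} - {0, k, p, anti p}) = 2 * k - 4" if "p \<in> {..<2 * k} - {0, k}" for p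
  proof -
    have "card {0, k, p, anti p} = 4" using that assms by (auto simp: anti_def card_insert_if)
    moreover have "{0, k, p, anti p} \<subseteq> {..<2 * k}" using that assms by (auto simp: anti_def)
    ultimately show ?thesis by (simp add: card_Diff_subset)
  qed
  moreover have "card ({..<2 * k} - {0, k}) = 2 * k - 2"
    using assms by (subst card_Diff_subset) (auto simp: card_insert_if)
  ultimately show ?thesis by (simp add: card_SigmaI)
qed

text \<open>A pair satisfying \<open>R\<close> gives a triangle with corner \<open>0\<close>; its
  membership in the other complex makes the same pair satisfy \<open>R'\<close>, and one common pair
  forces equality.\<close>

lemma inj_on_circ_faces:
  assumes k: "k > 0" shows "inj_on (circ_faces (2 * k) 1 0) (torus_adjs k)"
proof (rule inj_onI)
  fix R R' assume R: "R \<in> torus_adjs k" "R' \<in> torus_adjs k" "circ_faces (2 * k) 1 0 R = circ_faces (2 * k) 1 0 R'"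
  have "adj_pairs (2 * k) R \<noteq> {}" using card_torus_pairs[OF k R(1)] by auto
  then obtain p q where pq: "p < 2 * k" "q < 2 * k" "R (int p) (int q)"
    unfolding adj_pairs_def by blast
  have "valid k (int p) (int q)" using torus_valid(1) R pq by blast
  then have ne: "0 \<noteq> p" "0 \<noteq> q" "p \<noteq> q" by (metis valid_def dvd_0_right of_nat_0 diff_self)+
  have "0 < 2 * k" using k by simp
  note * = torus_triangle_iff[OF k _ this pq(1,2) ne]
  have "R' (int p) (int q)" using *[OF R(1)] *[OF R(2)] R(3) pq by simp
  then show "R = R'" using torus_adj_unique R pq by blast
qed

text \<open>The valid pairs are partitioned by the relations: twelve for each one in
  \<open>torus_adjs\<close> and, if 3 divides \<open>k\<close>, eight for the single relation shared
  by all octahedra.\<close>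

lemma card_tori:
  assumes k: "k \<ge> 3"
  shows "12 * card (tori k) + (if 3 dvd k then 8 else 0) = (2 * k - 2) * (2 * k - 4)"
proof -
  have k0: "k > 0" using k by simp
  have fin: "finite (tori k)" using tori_props(2)[OF k0] finite_circ_family by blast
  then have finR: "finite (torus_adjs k)"
    using inj_on_circ_faces[OF k0] unfolding tori_def by (rule finite_imageD)
  have "adj_pairs (2 * k) (valid k) =
      (\<Union>R\<in>torus_adjs k. adj_pairs (2 * k) R) \<union> adj_pairs (2 * k) (oct_adj k)"
  proof -
    have "valid k p q \<longleftrightarrow> (\<exists>R\<in>torus_adjs k. R p q) \<or> oct_adj k p q" for p q
      using torus_adj_exists torus_valid(1) oct_adj_def by blast
    then show ?thesis unfolding adj_pairs_def by auto
  qed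
  moreover have "(\<Union>R\<in>torus_adjs k. adj_pairs (2 * k) R) \<inter> adj_pairs (2 * k) (oct_adj k) = {}"
    using torus_valid(2) by (auto simp: adj_pairs_def)
  moreover have "card (\<Union>R\<in>torus_adjs k. adj_pairs (2 * k) R) = (\<Sum>R\<in>torus_adjs k. card (adj_pairs (2 * k) R))"
    using finR finite_adj_pairs torus_adj_unique
    by (intro card_UN_disjoint) (auto simp: adj_pairs_def)
  moreover have "(\<Sum>R\<in>torus_adjs k. card (adj_pairs (2 * k) R)) = 12 * card (torus_adjs k)"
    using card_torus_pairs[OF k0] by simp
  ultimately have "card (adj_pairs (2 * k) (valid k)) = 12 * card (torus_adjs k) + card (adj_pairs (2 * k) (oct_adj k))"
    using finR finite_adj_pairs by (simp add: card_Un_disjoint)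
  moreover have "card (tori k) = card (torus_adjs k)"
    unfolding tori_def using inj_on_circ_faces[OF k0] by (rule card_image)
  ultimately show ?thesis using card_valid_pairs[OF k] card_oct_pairs[OF k0] by simp
qed

section \<open>Identification of the octahedra\<close>

lemma oct_vertices:
  assumes "j < m"
  shows "vertices (circ_faces (2 * (3 * m)) m j (oct_adj (3 * m))) = (\<lambda>i. j + i * m) ` {..<6}" (is "_ = ?g ` _")
proof -
  interpret circulant "2 * (3 * m)" m j "oct_adj (3 * m)" "oct_cycle m" using circulant_oct assms .
  have "vset = ?g ` {..<6}"
  proof
    show "vset \<subseteq> ?g ` {..<6}"
    proof
      fix x assume "x \<in> vset"
      then have "x < 6 * m" "x mod m = j" unfolding vset_def by auto
      then have "x = ?g (x div m)" by (metis mod_div_mult_eq)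
      moreover note \<open>x < 6 * m\<close>
      ultimately show "x \<in> ?g ` {..<6}" by (metis image_eqI lessThan_iff less_mult_imp_div_less)
    qed
    show "?g ` {..<6} \<subseteq> vset"
    proof
      fix x assume "x \<in> ?g ` {..<6}"
      then obtain i where i: "i < 6" "x = j + i * m" by blast
      have "i * m \<le> 5 * m" using i by (intro mult_le_mono1) simp
      then have "x < 2 * (3 * m)" using assms i by linarith
      then show "x \<in> vset" unfolding vset_def using assms i by simp
    qed
  qed
  then show ?thesis unfolding vertices_K .
qed

text \<open>Brings the boundary of the octahedron into the form of \<open>circ_faces\<close>, for
  comparison by scaling.\<close>

lemma cross_boundary_3:
  "cross_boundary 3 = {s. s \<noteq> {} \<and> (\<exists>x y z. x < 6 \<and> y < 6 \<and> z < 6 \<and>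
     valid 3 (int y - int x) (int z - int x) \<and> s \<subseteq> {x, y, z})}"
proof -
  have *: "t \<in> cross_facets 3 \<longleftrightarrow> (\<exists>x y z. x < 6 \<and> y < 6 \<and> z < 6 \<and>
     valid 3 (int y - int x) (int z - int x) \<and> t = {x, y, z})" for t
  proof
    assume t: "t \<in> cross_facets 3"
    then obtain x y z where "t = {x, y, z}" "x \<noteq> y" "x \<noteq> z" "y \<noteq> z"
      by (auto simp: cross_facets_def card_3_iff)
    moreover from this t have "x < 6" "y < 6" "z < 6" by (auto simp: cross_facets_def)
    ultimately show "\<exists>x y z. x < 6 \<and> y < 6 \<and> z < 6 \<and> valid 3 (int y - int x) (int z - int x) \<and> t = {x, y, z}"
      using t valid_iff_no_diagonal[of x 3 y z] unfolding cross_facets_def by auto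
  next
    assume "\<exists>x y z. x < 6 \<and> y < 6 \<and> z < 6 \<and> valid 3 (int y - int x) (int z - int x) \<and> t = {x, y, z}"
    then obtain x y z where xyz: "x < 6" "y < 6" "z < 6" "valid 3 (int y - int x) (int z - int x)" "t = {x, y, z}"
      by blast
    then have "x \<noteq> y" "x \<noteq> z" "y \<noteq> z" "\<forall>i<3. \<not> {i, 3 + i} \<subseteq> t"
      using valid_iff_no_diagonal[of x 3 y z] by auto
    then show "t \<in> cross_facets 3" using xyz unfolding cross_facets_def by auto
  qed
  show ?thesis unfolding cross_boundary_def Bex_def * by (rule Collect_cong) blast
qed

text \<open>Sending \<open>i\<close> to \<open>j + i * m\<close>, with inverse division by
  \<open>m\<close>, multiplies differences by \<open>m\<close> and so carries \<open>valid 3\<close>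
  to \<open>oct_adj (3 * m)\<close>.\<close>

lemma oct_isomorphic:
  assumes j: "j < m"
  defines "S \<equiv> circ_faces (2 * (3 * m)) m j (oct_adj (3 * m))"
  shows "isomorphic_complexes S (cross_boundary 3)" "card (vertices S) = 6"
proof -
  define g where "g i = j + i * m" for i
  define f where "f x = x div m" for x
  have m: "m > 0" using j by simp
  have fg: "f (g i) = i" for i using j by (simp add: f_def g_def)
  have inj: "inj_on g A" for A using fg by (metis inj_on_inverseI)
  have V: "vertices S = g ` {..<6}" unfolding S_def oct_vertices[OF j] g_def ..
  then show "card (vertices S) = 6" by (simp add: card_image inj)
  interpret circulant "2 * (3 * m)" m j "oct_adj (3 * m)" "oct_cycle m" using circulant_oct j .
  have vset: "vset = g ` {..<6}" using V vertices_K by (simp add: S_def)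
  have val: "oct_adj (3 * m) (int (g y) - int (g x)) (int (g z) - int (g x)) \<longleftrightarrow>
      valid 3 (int y - int x) (int z - int x)" for x y z
  proof -
    have e: "int (g b) - int (g a) = int m * (int b - int a)" for a b by (simp add: g_def algebra_simps)
    have d: "int (3 * m) dvd int m * t \<longleftrightarrow> 3 dvd t" for t
      using m by (simp add: mult.commute)
    have "int m * (int z - int x) - int m * (int y - int x) = int m * (int z - int x - (int y - int x))"
      by (simp add: algebra_simps)
    then show ?thesis unfolding oct_adj_def valid_def e by (simp only: d) (simp add: mult.commute)
  qed
  have S: "S = (\<lambda>s. g ` s) ` cross_boundary 3"
  proof (rule set_eqI)
    fix s
    have "s \<in> S \<longleftrightarrow> s \<noteq> {} \<and> (\<exists>x<6. \<exists>y<6. \<exists>z<6. valid 3 (int y - int x) (int z - int x) \<and> s \<subseteq> g ` {x, y, z})"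
      unfolding S_def faces_alt vset by (simp add: val Bex_def)
    also have "\<dots> \<longleftrightarrow> s \<in> (\<lambda>s. g ` s) ` cross_boundary 3"
      unfolding cross_boundary_3 subset_image_iff by blast
    finally show "s \<in> S \<longleftrightarrow> s \<in> (\<lambda>s. g ` s) ` cross_boundary 3" .
  qed
  have V3: "vertices (cross_boundary 3) = {..<6}"
  proof -
    have "g ` vertices (cross_boundary 3) = vertices S" unfolding S vertices_def by blast
    then show ?thesis unfolding V using inj by (simp add: inj_on_image_eq_iff[OF inj[of UNIV]])
  qed
  have "bij_betw f (vertices S) (vertices (cross_boundary 3))"
    unfolding V V3 using fg by (intro bij_betw_byWitness[where f' = g]) auto
  moreover have "(\<lambda>s. f ` s) ` S = cross_boundary 3"
    unfolding S by (simp add: image_image fg)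
  ultimately show "isomorphic_complexes S (cross_boundary 3)"
    unfolding isomorphic_complexes_def simplicial_iso_def by blast
qed

text \<open>Vertices of different octahedra have different residues modulo \<open>m\<close>; the
  vertex sets being nonempty, the \<open>m\<close> complexes are also distinct.\<close>

lemma octahedra_disjoint:
  "pairwise (\<lambda>S T. vertices S \<inter> vertices T = {}) (octahedra (3 * m))" "card (octahedra (3 * m)) = m"
proof -
  let ?O = "\<lambda>j. circ_faces (2 * (3 * m)) m j (oct_adj (3 * m))"
  have o: "octahedra (3 * m) = ?O ` {..<m}" by (simp add: octahedra_def)
  have disj: "vertices (?O i) \<inter> vertices (?O j) = {}" if ij: "i < m" "j < m" "i \<noteq> j" for i j
  proof -
    have "x mod m = a" if "x \<in> vertices (?O a)" "a < m" for x a
      using that(1) unfolding oct_vertices[OF that(2)] using that(2) by auto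
    then show ?thesis using ij by blast
  qed
  then show "pairwise (\<lambda>S T. vertices S \<inter> vertices T = {}) (octahedra (3 * m))"
    unfolding o pairwise_def by blast
  have "inj_on ?O {..<m}"
  proof (rule inj_onI)
    fix i j assume ij: "i \<in> {..<m}" "j \<in> {..<m}" "?O i = ?O j"
    have "i < m" using ij(1) by simp
    then have "vertices (?O i) \<noteq> {}" unfolding oct_vertices[OF \<open>i < m\<close>] by (simp add: lessThan_empty_iff)
    then show "i = j" using disj[of i j] ij by auto
  qed
  then show "card (octahedra (3 * m)) = m" unfolding o by (simp add: card_image)
qed

theorem theorem1p1:
  fixes k :: nat
  assumes "k \<ge> 3"
  shows
    "(\<exists>\<F>. decomposes_into (cross_skel2 k) \<F> \<and> (\<forall>S\<in>\<F>. vertex_transitive S)) \<and>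
     (k mod 3 = 1 \<or> k mod 3 = 2 \<longrightarrow>
       (\<exists>\<F>. decomposes_into (cross_skel2 k) \<F> \<and>
            real (card \<F>) = (real k - 1) * (real k - 2) / 3 \<and>
            (\<forall>S\<in>\<F>. vertex_transitive S \<and> euler_char S = 0 \<and> card (vertices S) = 2 * k))) \<and>
     (k mod 3 = 0 \<longrightarrow>
       (\<exists>\<A> \<B>. decomposes_into (cross_skel2 k) (\<A> \<union> \<B>) \<and>
            real (card \<A>) = real k / 3 \<and>
            (\<forall>S\<in>\<A>. isomorphic_complexes S (cross_boundary 3) \<and> card (vertices S) = 6) \<and>
            pairwise (\<lambda>S T. vertices S \<inter> vertices T = {}) \<A> \<and>
            real (card \<B>) = real k * (real k - 3) / 3 \<and>
            (\<forall>S\<in>\<B>. vertex_transitive S \<and> euler_char S = 0 \<and> card (vertices S) = 2 * k)))"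
proof -
  have k: "k > 0" using assms by simp
  note dec = decomposition[OF k] and tor = tori_props[OF k]
  have "real (12 * card (tori k) + (if 3 dvd k then 8 else 0)) = real ((2 * k - 2) * (2 * k - 4))"
    using card_tori[OF assms] by simp
  \<comment> \<open>Since \<open>k\<close> is at least 3, the truncated subtractions agree with
    those of the reals.\<close>
  then have card: "12 * real (card (tori k)) + (if 3 dvd k then 8 else 0) = (2 * real k - 2) * (2 * real k - 4)"
    using assms by (simp add: of_nat_diff split: if_splits)
  show ?thesis
  proof (intro conjI impI)
    show "\<exists>\<F>. decomposes_into (cross_skel2 k) \<F> \<and> (\<forall>S\<in>\<F>. vertex_transitive S)"
      using dec tor(3) octahedra_props(3) by blast
    assume "k mod 3 = 1 \<or> k mod 3 = 2"
    then have n3: "\<not> 3 dvd k" by (auto simp: dvd_eq_mod_eq_0)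
    then have "octahedra k \<union> tori k = tori k" by (simp add: octahedra_def)
    moreover have "real (card (tori k)) = (real k - 1) * (real k - 2) / 3"
      using card n3 by (simp add: algebra_simps)
    ultimately show "\<exists>\<F>. decomposes_into (cross_skel2 k) \<F> \<and>
            real (card \<F>) = (real k - 1) * (real k - 2) / 3 \<and>
            (\<forall>S\<in>\<F>. vertex_transitive S \<and> euler_char S = 0 \<and> card (vertices S) = 2 * k)"
      using dec tor by metis
  next
    assume "k mod 3 = 0"
    then obtain m where km: "k = 3 * m" by (metis mod_0_imp_dvd dvdE)
    \<comment> \<open>The eight octahedral pairs cancel the constant term of (2k - 2)(2k - 4) = 4k^2
      - 12k + 8.\<close>
    have "real (card (tori k)) = real k * (real k - 3) / 3"
      using card by (simp add: km algebra_simps)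
    moreover have "real (card (octahedra k)) = real k / 3"
      using octahedra_disjoint(2)[of m] by (simp add: km)
    moreover have "isomorphic_complexes S (cross_boundary 3) \<and> card (vertices S) = 6" if "S \<in> octahedra k" for S
      using that oct_isomorphic unfolding octahedra_def km by auto
    ultimately show "\<exists>\<A> \<B>. decomposes_into (cross_skel2 k) (\<A> \<union> \<B>) \<and>
            real (card \<A>) = real k / 3 \<and>
            (\<forall>S\<in>\<A>. isomorphic_complexes S (cross_boundary 3) \<and> card (vertices S) = 6) \<and>
            pairwise (\<lambda>S T. vertices S \<inter> vertices T = {}) \<A> \<and>
            real (card \<B>) = real k * (real k - 3) / 3 \<and>
            (\<forall>S\<in>\<B>. vertex_transitive S \<and> euler_char S = 0 \<and> card (vertices S) = 2 * k)"
      using dec tor octahedra_disjoint(1)[of m, folded km] by blast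
  qed
qed

end
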